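(* Let $(\widehat W_n)$ be the sequence of estimators produced by the stochastic Gauss-Newton algorithm with parameters $\alpha,\beta,\gamma$. Assume that $\alpha\in[0,1/2[$ and $\alpha+\beta<1/2$. Suppose that the cost function $c$ satisfies, for every $1\le j\le J$, $$\int_{\mathcal X}c^2(x,y_j)\,d\mu(x)<+\infty.$$ Then $$\lim_{n\to+\infty}\widehat W_n=W_\varepsilon(\mu,\nu)\quad\text{a.s.}$$
   Context: **Optimal transport setting.** Let $\mathcal{X},\mathcal{Y}$ be metric spaces, $\mu$ a probability measure on $\mathcal{X}$, and $\nu=\sum_{j=1}^J \nu_j\delta_{y_j}$ a discrete probability measure on $\mathcal{Y}$ with finite support $\{y_1,\ldots,y_J\}$ of size $J$ and positive weights $\nu_j$ summing to one; $\nu$ also denotes the vector $(\nu_1,\ldots,\nu_J)^T$, and $\min(\nu)=\min_j\nu_j$, $\max(\nu)=\max_j\nu_j$. The cost $c:\mathcal{X}\times\mathcal{Y}\to\mathbb{R}$ is lower semi-continuous with $0\le c(x,y)\le c_{\mathcal X}(x)+c_{\mathcal Y}(y)$ for all $(x,y)$, where $c_{\mathcal X},c_{\mathcal Y}$ are real-valued, $\int c_{\mathcal X}\,d\mu<\infty$ and $\int c_{\mathcal Y}\,d\nu<\infty$. For $\varepsilon>0$ the regularized OT cost is $$W_\varepsilon(\mu,\nu)=\min_{\pi\in\Pi(\mu,\nu)}\int c\,d\pi+\varepsilon\,\mathrm{KL}(\pi|\mu\otimes\nu),\qquad \mathrm{KL}(\pi|\xi)=\int\Bigl(\log\frac{d\pi}{d\xi}-1\Bigr)d\pi,$$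 with $\Pi(\mu,\nu)$ the set of couplings of $\mu$ and $\nu$. For $x\in\mathcal X$, $v\in\mathbb{R}^J$ put $$h_\varepsilon(x,v)=\varepsilon+\varepsilon\log\Bigl(\sum_{j=1}^J \exp\Bigl(\frac{v_j-c(x,y_j)}{\varepsilon}\Bigr)\nu_j\Bigr)-\sum_{j=1}^J v_j\nu_j,\qquad H_\varepsilon(v)=\mathbb{E}[h_\varepsilon(X,v)],\quad X\sim\mu.$$ The semi-dual formulation gives $W_\varepsilon(\mu,\nu)=-\inf_{v\in\mathbb{R}^J}H_\varepsilon(v)$. Explicitly $\nabla_v h_\varepsilon(x,v)=\pi(x,v)-\nu$ with $\pi_j(x,v)=\nu_j e^{(v_j-c(x,y_j))/\varepsilon}/\sum_{k}\nu_k e^{(v_k-c(x,y_k))/\varepsilon}$. Let $\boldsymbol{v}_J=J^{-1/2}(1,\ldots,1)^T$, let $\langle\boldsymbol{v}_J\rangle^\perp$ be its orthogonal complement in $\mathbb{R}^J$, and $P_J=I_J-\boldsymbol{v}_J\boldsymbol{v}_J^T$. It is assumed that $H_\varepsilon$ admits a minimizer on $\mathbb{R}^J$; $v^\ast$ denotes its unique minimizer in $\langle\boldsymbol{v}_J\rangle^\perp$, so $W_\varepsilon(\mu,\nu)=-H_\varepsilon(v^\ast)$. Put $G_\varepsilon(v)=\mathbb{E}[\nabla_v h_\varepsilon(X,v)\nabla_v h_\varepsilon(X,v)^T]$. **Standing assumptions.** (i) $\min\{v^TG_\varepsilon(v^\ast)v/\|v\|^2:\ v\in\langle\boldsymbol{v}_J\rangle^\perp,\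 v\ne0\}>0$. (ii) $\varepsilon\le \min(\nu)/(\max(\nu)-\min(\nu))$ (no restriction if $\max(\nu)=\min(\nu)$). **Stochastic Gauss-Newton (SGN) algorithm.** Let $(X_n)_{n\ge1}$ be i.i.d. with distribution $\mu$, and fix constants $0\le\alpha<1/2$, $0<\beta<1/2$, $\gamma>0$. Let $\widehat V_0$ be a square integrable random vector with values in $\langle\boldsymbol{v}_J\rangle^\perp$, independent of $(X_n)$. With $(e_1,\ldots,e_J)$ the canonical basis of $\mathbb{R}^J$, $\ell_k=1+((k-1)\bmod J)$ and $Z_k=\sqrt{\nu_{\ell_k}}\,e_{\ell_k}$, define $S_0=I_J$ and, recursively, $$\widehat V_{n+1}=P_J\bigl(\widehat V_n-n^\alpha S_n^{-1}\nabla_vh_\varepsilon(X_{n+1},\widehat V_n)\bigr)\quad(n\ge0),$$ $$S_n=S_{n-1}+\nabla_vh_\varepsilon(X_n,\widehat V_{n-1})\nabla_vh_\varepsilon(X_n,\widehat V_{n-1})^T+\gamma\Bigl(1+\Bigl\lfloor\frac nJ\Bigr\rfloor\Bigr)^{-\beta}Z_nZ_n^T\quad(n\ge1).$$ (For $\alpha=0$, $n^\alpha=1$ for all $n\ge0$.) The estimator of $W_\varepsilon(\mu,\nu)$ is $$\widehat W_n=-\frac1n\sum_{k=1}^nh_\varepsilon(X_k,\widehat V_{k-1}).$$ *)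

theory Defs
  imports "HOL-Probability.Probability"
begin

section \<open>Regularized optimal transport\<close>

definition lower_semicontinuous :: "('z::topological_space \<Rightarrow> real) \<Rightarrow> bool" where
  "lower_semicontinuous f \<longleftrightarrow> (\<forall>z. \<forall>a < f z. \<forall>\<^sub>F z' in nhds z. a < f z')"

definition couplings :: "'a measure \<Rightarrow> 'b measure \<Rightarrow> ('a \<times> 'b) measure set" where
  "couplings \<mu> \<nu> = {\<pi>. sets \<pi> = sets (\<mu> \<Otimes>\<^sub>M \<nu>) \<and> distr \<pi> \<mu> fst = \<mu> \<and> distr \<pi> \<nu> snd = \<nu>}"

text \<open>For probability measures with \<open>\<pi>\<close> absolutely continuous, the negative part of
  \<open>ln (d\<pi>/d\<xi>)\<close> is always \<open>\<pi>\<close>-integrable, so that non-integrability means that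
  the integral is \<open>\<infinity>\<close>.\<close>

definition KL :: "'z measure \<Rightarrow> 'z measure \<Rightarrow> ereal" where
  "KL \<pi> \<xi> =
     (if absolutely_continuous \<xi> \<pi> \<and> integrable \<pi> (\<lambda>z. ln (enn2real (RN_deriv \<xi> \<pi> z)) - 1)
      then ereal (LINT z|\<pi>. ln (enn2real (RN_deriv \<xi> \<pi> z)) - 1)
      else \<infinity>)"

text \<open>The cost is nonnegative, so its integral is taken in \<^typ>\<open>ennreal\<close>. On non-separable
  spaces a lower semicontinuous cost need not be measurable for the product sigma-algebra; but
  a coupling with a finitely supported \<open>\<nu>\<close> lives on finitely many slices, on which it is,
  and the nonnegative integral (a supremum over simple functions) ignores the null complement.\<close>

definition W_reg :: "real \<Rightarrow> ('a \<Rightarrow> 'b \<Rightarrow> real) \<Rightarrow> 'a measure \<Rightarrow> 'b measure \<Rightarrow> ereal" where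
  "W_reg \<epsilon> c \<mu> \<nu> =
     (INF \<pi> \<in> couplings \<mu> \<nu>.
        enn2ereal (\<integral>\<^sup>+z. ennreal (c (fst z) (snd z)) \<partial>\<pi>) + ereal \<epsilon> * KL \<pi> (\<mu> \<Otimes>\<^sub>M \<nu>))"

text \<open>The measure \<open>\<Sum>\<^sub>j w\<^sub>j \<delta>(y\<^sub>j)\<close>.\<close>

definition discrete_measure :: "('j::finite \<Rightarrow> 'b::topological_space) \<Rightarrow> real ^ 'j \<Rightarrow> 'b measure" where
  "discrete_measure y w = distr (point_measure UNIV (\<lambda>j. ennreal (w $ j))) borel y"

lemma emeasure_discrete_measure:
  assumes "A \<in> sets borel"
  shows "emeasure (discrete_measure y w) A = (\<Sum>j\<in>UNIV. ennreal (w $ j) * indicator A (y j))"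
proof -
  have m: "y \<in> measurable (point_measure UNIV (\<lambda>j. ennreal (w $ j))) borel"
    by (simp add: point_measure_def)
  have "emeasure (discrete_measure y w) A = (\<Sum>j\<in>y -` A. ennreal (w $ j))"
    unfolding discrete_measure_def
    by (subst emeasure_distr[OF m assms])
      (simp add: space_point_measure emeasure_point_measure_finite)
  also have "\<dots> = (\<Sum>j\<in>UNIV. ennreal (w $ j) * indicator A (y j))"
    by (rule sum.mono_neutral_cong_left) auto
  finally show ?thesis .
qed

section \<open>The semi-dual objective\<close>

definition h_eps :: "real \<Rightarrow> ('a \<Rightarrow> 'b \<Rightarrow> real) \<Rightarrow> ('j::finite \<Rightarrow> 'b) \<Rightarrow> real ^ 'j \<Rightarrow> 'a \<Rightarrow> real ^ 'j \<Rightarrow> real" where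
  "h_eps \<epsilon> c y w x v =
     \<epsilon> + \<epsilon> * ln (\<Sum>j\<in>UNIV. exp ((v $ j - c x (y j)) / \<epsilon>) * w $ j) - (\<Sum>j\<in>UNIV. v $ j * w $ j)"

definition H_eps :: "real \<Rightarrow> ('a \<Rightarrow> 'b \<Rightarrow> real) \<Rightarrow> ('j::finite \<Rightarrow> 'b) \<Rightarrow> real ^ 'j \<Rightarrow> 'a measure \<Rightarrow> real ^ 'j \<Rightarrow> real" where
  "H_eps \<epsilon> c y w \<mu> v = (LINT x|\<mu>. h_eps \<epsilon> c y w x v)"

definition pi_vec :: "real \<Rightarrow> ('a \<Rightarrow> 'b \<Rightarrow> real) \<Rightarrow> ('j::finite \<Rightarrow> 'b) \<Rightarrow> real ^ 'j \<Rightarrow> 'a \<Rightarrow> real ^ 'j \<Rightarrow> real ^ 'j" where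
  "pi_vec \<epsilon> c y w x v =
     (\<chi> j. w $ j * exp ((v $ j - c x (y j)) / \<epsilon>)
           / (\<Sum>k\<in>UNIV. w $ k * exp ((v $ k - c x (y k)) / \<epsilon>)))"

definition grad_h :: "real \<Rightarrow> ('a \<Rightarrow> 'b \<Rightarrow> real) \<Rightarrow> ('j::finite \<Rightarrow> 'b) \<Rightarrow> real ^ 'j \<Rightarrow> 'a \<Rightarrow> real ^ 'j \<Rightarrow> real ^ 'j" where
  "grad_h \<epsilon> c y w x v = pi_vec \<epsilon> c y w x v - w"

lemma GDERIV_h_eps:
  fixes w :: "real ^ 'j::finite"
  assumes "\<epsilon> \<noteq> 0" and w: "\<And>j. 0 < w $ j"
  shows "GDERIV (h_eps \<epsilon> c y w x) v :> grad_h \<epsilon> c y w x v"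
proof -
  define E where "E = (\<lambda>j (v :: real ^ 'j). exp ((v $ j - c x (y j)) / \<epsilon>))"
  define S where "S = (\<Sum>k\<in>UNIV. E k v * w $ k)"
  have S: "0 < S"
    unfolding S_def E_def by (rule sum_pos) (auto simp: w)
  have nth: "((\<lambda>v :: real ^ 'j. v $ j) has_derivative (\<lambda>u. u $ j)) (at v)" for j
    by (rule bounded_linear_imp_has_derivative[OF bounded_linear_vec_nth])
  have E: "(E j has_derivative (\<lambda>u. E j v * (u $ j / \<epsilon>))) (at v)" for j
    unfolding E_def using \<open>\<epsilon> \<noteq> 0\<close> by (auto intro!: derivative_eq_intros nth)
  have sumE: "((\<lambda>v. \<Sum>k\<in>UNIV. E k v * w $ k) has_derivative
      (\<lambda>u. \<Sum>k\<in>UNIV. E k v * (u $ k / \<epsilon>) * w $ k)) (at v)"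
    by (intro has_derivative_sum has_derivative_mult_left E)
  have "((\<lambda>v. ln (\<Sum>k\<in>UNIV. E k v * w $ k)) has_derivative
      (\<lambda>u. (\<Sum>k\<in>UNIV. E k v * (u $ k / \<epsilon>) * w $ k) * inverse S)) (at v)"
    using has_derivative_ln[OF _ sumE] S unfolding S_def by (simp add: divide_inverse)
  moreover have "((\<lambda>v. \<Sum>k\<in>UNIV. v $ k * w $ k) has_derivative (\<lambda>u. \<Sum>k\<in>UNIV. u $ k * w $ k)) (at v)"
    by (intro has_derivative_sum has_derivative_mult_left nth)
  ultimately have "((\<lambda>v. \<epsilon> + \<epsilon> * ln (\<Sum>k\<in>UNIV. E k v * w $ k) - (\<Sum>k\<in>UNIV. v $ k * w $ k))
      has_derivative (\<lambda>u. 0 + \<epsilon> * ((\<Sum>k\<in>UNIV. E k v * (u $ k / \<epsilon>) * w $ k) * inverse S)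
        - (\<Sum>k\<in>UNIV. u $ k * w $ k))) (at v)"
    by (intro has_derivative_diff has_derivative_add has_derivative_const has_derivative_mult_right)
  then have "(h_eps \<epsilon> c y w x has_derivative
      (\<lambda>u. 0 + \<epsilon> * ((\<Sum>k\<in>UNIV. E k v * (u $ k / \<epsilon>) * w $ k) * inverse S)
        - (\<Sum>k\<in>UNIV. u $ k * w $ k))) (at v)"
    unfolding h_eps_def E_def .
  moreover have "0 + \<epsilon> * ((\<Sum>k\<in>UNIV. E k v * (u $ k / \<epsilon>) * w $ k) * inverse S)
      - (\<Sum>k\<in>UNIV. u $ k * w $ k) = u \<bullet> grad_h \<epsilon> c y w x v" for u
  proof -
    have S': "(\<Sum>k\<in>UNIV. w $ k * E k v) = S"
      by (simp add: S_def mult.commute)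
    have "pi_vec \<epsilon> c y w x v = (\<chi> j. w $ j * E j v / S)"
      unfolding pi_vec_def S'[symmetric] E_def ..
    then show ?thesis
      using \<open>\<epsilon> \<noteq> 0\<close> S
      by (simp add: grad_h_def inner_vec_def sum_distrib_left sum_distrib_right
          sum_subtractf[symmetric] field_simps)
  qed
  ultimately show ?thesis
    unfolding gderiv_def by (simp add: inner_commute)
qed

definition outer :: "real ^ 'j \<Rightarrow> real ^ 'j \<Rightarrow> real ^ 'j ^ 'j" where
  "outer a b = (\<chi> i j. a $ i * b $ j)"

definition G_eps :: "real \<Rightarrow> ('a \<Rightarrow> 'b \<Rightarrow> real) \<Rightarrow> ('j::finite \<Rightarrow> 'b) \<Rightarrow> real ^ 'j \<Rightarrow> 'a measure \<Rightarrow> real ^ 'j \<Rightarrow> real ^ 'j ^ 'j" where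
  "G_eps \<epsilon> c y w \<mu> v = (LINT x|\<mu>. outer (grad_h \<epsilon> c y w x v) (grad_h \<epsilon> c y w x v))"

definition v_unit :: "real ^ 'j::finite" where
  "v_unit = (\<chi> j. 1 / sqrt (real CARD('j)))"

definition v_perp :: "(real ^ 'j::finite) set" where
  "v_perp = (span {v_unit})\<^sup>\<bottom>"

definition P_mat :: "real ^ 'j ^ 'j::finite" where
  "P_mat = mat 1 - outer v_unit v_unit"

text \<open>The minimum of the Rayleigh quotient over \<open>\<langle>v_unit\<rangle>\<^sup>\<bottom>\<close>; extended reals give the
  value \<open>\<infinity>\<close> on the empty range when \<open>J = 1\<close>.\<close>

definition min_rayleigh_perp :: "real ^ 'j ^ 'j::finite \<Rightarrow> ereal" where
  "min_rayleigh_perp A = (INF v \<in> v_perp - {0}. ereal (v \<bullet> (A *v v) / (norm v)\<^sup>2))"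

section \<open>The stochastic Gauss-Newton algorithm\<close>

text \<open>The isolated case is \<open>0\<^sup>0 = 1\<close>, since \<^term>\<open>0 powr 0 = (0::real)\<close>.\<close>

definition gain :: "real \<Rightarrow> nat \<Rightarrow> real" where
  "gain \<alpha> n = (if \<alpha> = 0 then 1 else real n powr \<alpha>)"

text \<open>The coordinates are indexed by a finite type, which carries no order; \<open>lab\<close> enumerates it
  as \<open>lab 1, \<dots>, lab J\<close>.\<close>

definition Z_vec :: "(nat \<Rightarrow> 'j) \<Rightarrow> real ^ 'j \<Rightarrow> nat \<Rightarrow> real ^ 'j::finite" where
  "Z_vec lab w k =
     (let l = lab (1 + (k - 1) mod CARD('j)) in sqrt (w $ l) *\<^sub>R axis l 1)"

fun sgn_V :: "real \<Rightarrow> ('a \<Rightarrow> 'b \<Rightarrow> real) \<Rightarrow> ('j::finite \<Rightarrow> 'b) \<Rightarrow> real ^ 'j \<Rightarrow> (nat \<Rightarrow> 'j)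
      \<Rightarrow> real \<Rightarrow> real \<Rightarrow> real \<Rightarrow> real ^ 'j \<Rightarrow> (nat \<Rightarrow> 'a) \<Rightarrow> nat \<Rightarrow> real ^ 'j"
  and sgn_S :: "real \<Rightarrow> ('a \<Rightarrow> 'b \<Rightarrow> real) \<Rightarrow> ('j::finite \<Rightarrow> 'b) \<Rightarrow> real ^ 'j \<Rightarrow> (nat \<Rightarrow> 'j)
      \<Rightarrow> real \<Rightarrow> real \<Rightarrow> real \<Rightarrow> real ^ 'j \<Rightarrow> (nat \<Rightarrow> 'a) \<Rightarrow> nat \<Rightarrow> real ^ 'j ^ 'j"
where
  "sgn_V \<epsilon> c y w lab \<alpha> \<beta> \<gamma> v0 x 0 = v0"
| "sgn_V \<epsilon> c y w lab \<alpha> \<beta> \<gamma> v0 x (Suc n) =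
     (let v = sgn_V \<epsilon> c y w lab \<alpha> \<beta> \<gamma> v0 x n
      in P_mat *v (v - gain \<alpha> n *\<^sub>R
           (matrix_inv (sgn_S \<epsilon> c y w lab \<alpha> \<beta> \<gamma> v0 x n) *v grad_h \<epsilon> c y w (x (Suc n)) v)))"
| "sgn_S \<epsilon> c y w lab \<alpha> \<beta> \<gamma> v0 x 0 = mat 1"
| "sgn_S \<epsilon> c y w lab \<alpha> \<beta> \<gamma> v0 x (Suc n) =
     (let g = grad_h \<epsilon> c y w (x (Suc n)) (sgn_V \<epsilon> c y w lab \<alpha> \<beta> \<gamma> v0 x n);
          z = Z_vec lab w (Suc n)
      in sgn_S \<epsilon> c y w lab \<alpha> \<beta> \<gamma> v0 x n + outer g g
         + (\<gamma> * (1 + real (Suc n div CARD('j))) powr (- \<beta>)) *\<^sub>R outer z z)"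

definition W_hat :: "real \<Rightarrow> ('a \<Rightarrow> 'b \<Rightarrow> real) \<Rightarrow> ('j::finite \<Rightarrow> 'b) \<Rightarrow> real ^ 'j \<Rightarrow> (nat \<Rightarrow> 'j)
      \<Rightarrow> real \<Rightarrow> real \<Rightarrow> real \<Rightarrow> real ^ 'j \<Rightarrow> (nat \<Rightarrow> 'a) \<Rightarrow> nat \<Rightarrow> real" where
  "W_hat \<epsilon> c y w lab \<alpha> \<beta> \<gamma> v0 x n =
     - (1 / real n) * (\<Sum>k=1..n. h_eps \<epsilon> c y w (x k) (sgn_V \<epsilon> c y w lab \<alpha> \<beta> \<gamma> v0 x (k - 1)))"

end

theory Submission
  imports Defs
begin

text \<open>Write \<open>W\<close> for the regularized cost, \<open>v\<^sub>n\<close> and \<open>S\<^sub>n\<close> for the iterates and matrices of the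
  algorithm, \<open>x\<^sub>n\<close> for the samples, and \<open>F\<^sub>n\<close> for the sigma-algebra of the initial vector and the
  first \<open>n\<close> samples.  The estimator averages \<open>- h(x\<^sub>k, v\<^sub>k\<^sub>-\<^sub>1)\<close>.  Since \<open>x\<^sub>k\<close> is independent of
  \<open>F\<^sub>k\<^sub>-\<^sub>1\<close>, each summand is \<open>- H(v\<^sub>k\<^sub>-\<^sub>1)\<close> plus a martingale difference, so three facts suffice:
  \<open>W\<close> is minus the minimum of \<open>H\<close>, \<open>H(v\<^sub>n)\<close> tends almost surely to this minimum, and the martingale
  differences average to zero.

  The first fact is semi-duality (\<open>W_reg_eq\<close>).  Young's inequality for \<open>t ln t - t\<close> and its
  conjugate \<open>exp\<close> shows that every coupling costs at least \<open>- H(v)\<close>, for every \<open>v\<close>; the Gibbs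
  density built from a minimizer attains the bound, and its second marginal is correct exactly because
  the gradient of \<open>H\<close> vanishes there.

  For the second fact (\<open>H_V_tendsto\<close>), \<open>H\<close> itself is the Lyapunov function.  It is convex with a
  Lipschitz gradient, and \<open>S\<^sub>n\<close> lies between a multiple of \<open>n\<^sup>1\<^sup>-\<^sup>\<beta>\<close> and a multiple of \<open>n\<close>: the damping
  vectors run through all coordinates, whereas the gradients are bounded.  One step therefore
  decreases \<open>H\<close> by at least a multiple of the squared gradient of \<open>H\<close> divided by \<open>n\<close>, up to a
  martingale difference of size at most a multiple of \<open>n\<^sup>\<alpha>\<^sup>+\<^sup>\<beta>\<^sup>-\<^sup>1\<close> and a remainder of the squared size.
  As \<open>\<alpha> + \<beta> < 1/2\<close>, these sizes are square summable, so the noise has an almost surely convergent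
  series (\<open>AE_summable\<close>), \<open>H(v\<^sub>n)\<close> converges, and the squared gradients weighted by \<open>1/n\<close> have a
  finite sum.  Because \<open>H\<close> is coercive on the hyperplane containing the iterates, these are bounded,
  and by convexity \<open>H(v\<^sub>n) - min H\<close> is at most a constant times the norm of the gradient.  Since the
  harmonic series diverges, the limit of \<open>H(v\<^sub>n)\<close> is the minimum.

  For the third fact (\<open>AE_mean_fluctuation\<close>), bounding all steps gives a norm of \<open>v\<^sub>n\<close> that grows at
  most like \<open>n\<^sup>\<alpha>\<^sup>+\<^sup>\<beta>\<close>.  The martingale differences divided by their index then have summable second
  moments, and Kronecker's lemma applies.\<close>

section \<open>Semicontinuous costs\<close>

lemma lower_semicontinuous_borel:
  fixes f :: "'a::topological_space \<Rightarrow> real"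
  assumes "lower_semicontinuous f"
  shows "f \<in> borel_measurable borel"
proof (rule borel_measurableI_greater)
  fix a
  have "open {x. a < f x}"
  proof (subst open_subopen, safe)
    fix x assume "a < f x"
    then have "\<forall>\<^sub>F x' in nhds x. a < f x'"
      using assms by (simp add: lower_semicontinuous_def)
    then show "\<exists>T. open T \<and> x \<in> T \<and> T \<subseteq> {x. a < f x}"
      unfolding eventually_nhds by (simp add: subset_eq)
  qed
  then show "{x \<in> space borel. a < f x} \<in> sets borel"
    by simp
qed

text \<open>On a non-separable space a semicontinuous cost may fail to be measurable for the product
  sigma-algebra, but each of its slices is semicontinuous, hence Borel.\<close>

lemma lower_semicontinuous_slice:
  assumes "lower_semicontinuous (\<lambda>(x, z). c x z)"
  shows "lower_semicontinuous (\<lambda>x. c x z)"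
  unfolding lower_semicontinuous_def
proof (intro allI impI)
  fix x a assume "a < c x z"
  then have "\<forall>\<^sub>F p in nhds (x, z). a < (case p of (x, z) \<Rightarrow> c x z)"
    using assms unfolding lower_semicontinuous_def by simp
  moreover have "((\<lambda>x. (x, z)) \<longlongrightarrow> (x, z)) (nhds x)"
    by (intro tendsto_Pair tendsto_const filterlim_ident)
  ultimately have "\<forall>\<^sub>F x' in nhds x. a < (case (x', z) of (x, z) \<Rightarrow> c x z)"
    by (rule eventually_compose_filterlim)
  then show "\<forall>\<^sub>F x' in nhds x. a < c x' z"
    by (simp only: prod.case)
qed

section \<open>Square integrable martingale differences\<close>

text \<open>Orthogonality to the past functions \<open>Y\<close> with an integrable product replaces a vanishing conditional
  expectation; it is what Fubini's theorem provides for a fresh independent sample.  The difference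
  with index \<open>n\<close> belongs to \<open>F (Suc n)\<close> and is orthogonal to \<open>F n\<close>.\<close>

locale L2_martingale_diff = prob_space M for M :: "'w measure" +
  fixes F :: "nat \<Rightarrow> 'w measure" and \<xi> :: "nat \<Rightarrow> 'w \<Rightarrow> real"
  assumes subalg: "\<And>n. subalgebra M (F n)"
    and F_mono: "\<And>m n. m \<le> n \<Longrightarrow> sets (F m) \<subseteq> sets (F n)"
    and adapted: "\<And>n. \<xi> n \<in> borel_measurable (F (Suc n))"
    and L2: "\<And>n. integrable M (\<lambda>\<omega>. (\<xi> n \<omega>)\<^sup>2)"
    and orth: "\<And>n Y. Y \<in> borel_measurable (F n) \<Longrightarrow> integrable M (\<lambda>\<omega>. Y \<omega> * \<xi> n \<omega>)
      \<Longrightarrow> (LINT \<omega>|M. Y \<omega> * \<xi> n \<omega>) = 0"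
begin

lemma measurable_F_mono: "m \<le> n \<Longrightarrow> f \<in> measurable (F m) N \<Longrightarrow> f \<in> measurable (F n) N"
  using F_mono[of m n] subalg[of m] subalg[of n]
  by (auto simp: measurable_def subalgebra_def)

lemma measurable_F_M: "f \<in> measurable (F n) N \<Longrightarrow> f \<in> measurable M N"
  using subalg[of n] measurable_from_subalg by blast

lemma xi_M [measurable]: "\<xi> n \<in> borel_measurable M"
  using adapted measurable_F_M by blast

lemma integrable_mult_L2:
  assumes [measurable]: "f \<in> borel_measurable M" "g \<in> borel_measurable M"
    and f: "integrable M (\<lambda>\<omega>. (f \<omega>)\<^sup>2)" and g: "integrable M (\<lambda>\<omega>. (g \<omega>)\<^sup>2)"
  shows "integrable M (\<lambda>\<omega>. f \<omega> * g \<omega> :: real)"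
proof (rule Bochner_Integration.integrable_bound)
  show "integrable M (\<lambda>\<omega>. (f \<omega>)\<^sup>2 + (g \<omega>)\<^sup>2)"
    using f g by simp
  have "\<bar>a * b\<bar> \<le> a\<^sup>2 + b\<^sup>2" for a b :: real
  proof -
    have "2 * (\<bar>a\<bar> * \<bar>b\<bar>) \<le> a\<^sup>2 + b\<^sup>2"
      using sum_squares_bound[of "\<bar>a\<bar>" "\<bar>b\<bar>"] by (simp add: mult.assoc)
    moreover have "0 \<le> \<bar>a\<bar> * \<bar>b\<bar>"
      by simp
    ultimately show ?thesis
      unfolding abs_mult by linarith
  qed
  then show "AE \<omega> in M. norm (f \<omega> * g \<omega>) \<le> norm ((f \<omega>)\<^sup>2 + (g \<omega>)\<^sup>2)"
    by simp
qed measurable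

text \<open>By orthogonality the second moment of a sum of martingale differences is the sum of their second
  moments.  The predictable factors \<open>\<theta>\<close> are there to encode stopping.\<close>

lemma transform_sum_L2:
  assumes chi: "\<And>n. \<theta> n \<in> borel_measurable (F n)" and chi_bdd: "\<And>n \<omega>. \<bar>\<theta> n \<omega>\<bar> \<le> 1"
  shows "integrable M (\<lambda>\<omega>. (\<Sum>i\<in>{m..<n}. \<theta> i \<omega> * \<xi> i \<omega>)\<^sup>2)"
    and "(LINT \<omega>|M. (\<Sum>i\<in>{m..<n}. \<theta> i \<omega> * \<xi> i \<omega>)\<^sup>2) \<le> (\<Sum>i\<in>{m..<n}. LINT \<omega>|M. (\<xi> i \<omega>)\<^sup>2)"
proof -
  define T where "T n \<omega> = (\<Sum>i\<in>{m..<n}. \<theta> i \<omega> * \<xi> i \<omega>)" for n \<omega>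
  have chiM [measurable]: "\<theta> n \<in> borel_measurable M" for n
    using chi measurable_F_M by blast
  have chi_le: "(\<theta> n \<omega> * \<xi> n \<omega>)\<^sup>2 \<le> (\<xi> n \<omega>)\<^sup>2" for n \<omega>
    using power_mono[OF chi_bdd, of n \<omega> 2] by (simp add: power_mult_distrib mult_left_le_one_le)
  have chi_int: "integrable M (\<lambda>\<omega>. (\<theta> n \<omega> * \<xi> n \<omega>)\<^sup>2)" for n
    by (rule Bochner_Integration.integrable_bound[OF L2[of n]]) (auto simp: chi_le)
  have TF: "(\<lambda>\<omega>. T n \<omega> * \<theta> n \<omega>) \<in> borel_measurable (F n)" for n
  proof -
    have "\<theta> i \<in> borel_measurable (F n)" "\<xi> i \<in> borel_measurable (F n)" if "i < n" for i
      using that measurable_F_mono[OF _ chi[of i]] measurable_F_mono[OF _ adapted[of i]] by auto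
    then show ?thesis
      unfolding T_def using chi by (intro borel_measurable_times borel_measurable_sum) auto
  qed
  have TM [measurable]: "T n \<in> borel_measurable M" for n
    unfolding T_def by measurable
  have "integrable M (\<lambda>\<omega>. (T n \<omega>)\<^sup>2) \<and> (LINT \<omega>|M. (T n \<omega>)\<^sup>2) \<le> (\<Sum>i\<in>{m..<n}. LINT \<omega>|M. (\<xi> i \<omega>)\<^sup>2)"
  proof (induction n)
    case 0
    show ?case by (simp add: T_def)
  next
    case (Suc n)
    show ?case
    proof (cases "m \<le> n")
      case False
      then show ?thesis by (simp add: T_def)
    next
      case True
      have T_Suc: "T (Suc n) \<omega> = T n \<omega> + \<theta> n \<omega> * \<xi> n \<omega>" for \<omega>
        using True by (simp add: T_def)
      have cross: "integrable M (\<lambda>\<omega>. T n \<omega> * (\<theta> n \<omega> * \<xi> n \<omega>))"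
        using Suc.IH chi_int by (intro integrable_mult_L2) auto
      have cross0: "(LINT \<omega>|M. T n \<omega> * (\<theta> n \<omega> * \<xi> n \<omega>)) = 0"
        using orth[OF TF[of n]] cross by (simp add: mult.assoc)
      have sq: "(T (Suc n) \<omega>)\<^sup>2 = (T n \<omega>)\<^sup>2 + 2 * (T n \<omega> * (\<theta> n \<omega> * \<xi> n \<omega>)) + (\<theta> n \<omega> * \<xi> n \<omega>)\<^sup>2" for \<omega>
        by (simp add: T_Suc power2_eq_square algebra_simps)
      have "(LINT \<omega>|M. (T (Suc n) \<omega>)\<^sup>2) = (LINT \<omega>|M. (T n \<omega>)\<^sup>2) + (LINT \<omega>|M. (\<theta> n \<omega> * \<xi> n \<omega>)\<^sup>2)"
        unfolding sq using Suc.IH cross chi_int[of n] cross0 by simp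
      also have "\<dots> \<le> (\<Sum>i\<in>{m..<n}. LINT \<omega>|M. (\<xi> i \<omega>)\<^sup>2) + (LINT \<omega>|M. (\<xi> n \<omega>)\<^sup>2)"
        using Suc.IH by (intro add_mono integral_mono chi_int L2 chi_le) auto
      finally show ?thesis
        using True Suc.IH cross chi_int[of n] unfolding sq by simp
    qed
  qed
  then show "integrable M (\<lambda>\<omega>. (\<Sum>i\<in>{m..<n}. \<theta> i \<omega> * \<xi> i \<omega>)\<^sup>2)"
    and "(LINT \<omega>|M. (\<Sum>i\<in>{m..<n}. \<theta> i \<omega> * \<xi> i \<omega>)\<^sup>2) \<le> (\<Sum>i\<in>{m..<n}. LINT \<omega>|M. (\<xi> i \<omega>)\<^sup>2)"
    unfolding T_def by auto
qed

text \<open>Kolmogorov's argument: stop the sum once it has reached the level \<open>t\<close>.  The stopped sum is again a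
  sum of martingale differences, and on the event in question its absolute value is still at least \<open>t\<close> at time \<open>n\<close>,
  so Markov's inequality for its square gives the bound.\<close>

lemma maximal_inequality:
  assumes "0 < t"
  shows "prob {\<omega> \<in> space M. \<exists>k\<in>{m..n}. t \<le> \<bar>\<Sum>i\<in>{m..<k}. \<xi> i \<omega>\<bar>}
    \<le> (\<Sum>i\<in>{m..<n}. LINT \<omega>|M. (\<xi> i \<omega>)\<^sup>2) / t\<^sup>2"
proof -
  define \<theta> where "\<theta> i \<omega> = (if \<forall>k\<in>{m..i}. \<bar>\<Sum>l\<in>{m..<k}. \<xi> l \<omega>\<bar> < t then 1 else 0 :: real)" for i \<omega>
  have chi: "\<theta> i \<in> borel_measurable (F i)" for i
  proof -
    have [measurable]: "\<xi> l \<in> borel_measurable (F i)" if "l < i" for l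
      using measurable_F_mono[OF _ adapted[of l], of i] that by simp
    have [measurable]: "(\<lambda>\<omega>. \<Sum>l\<in>{m..<k}. \<xi> l \<omega>) \<in> borel_measurable (F i)" if "k \<in> {m..i}" for k
      using that by (intro borel_measurable_sum) simp
    have "{\<omega> \<in> space (F i). \<forall>k\<in>{m..i}. \<bar>\<Sum>l\<in>{m..<k}. \<xi> l \<omega>\<bar> < t} \<in> sets (F i)"
      by measurable
    then show ?thesis
      unfolding \<theta>_def by (intro measurable_If) auto
  qed
  define T where "T \<omega> = (\<Sum>i\<in>{m..<n}. \<theta> i \<omega> * \<xi> i \<omega>)" for \<omega>
  have bdd: "\<bar>\<theta> i \<omega>\<bar> \<le> 1" for i \<omega>
    by (simp add: \<theta>_def)
  note T = transform_sum_L2[of \<theta> m n, OF chi bdd, folded T_def]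
  have [measurable]: "\<theta> i \<in> borel_measurable M" for i
    using chi measurable_F_M by blast
  have TM [measurable]: "T \<in> borel_measurable M"
    unfolding T_def[abs_def] by measurable
  have sub: "{\<omega> \<in> space M. \<exists>k\<in>{m..n}. t \<le> \<bar>\<Sum>i\<in>{m..<k}. \<xi> i \<omega>\<bar>}
      \<subseteq> {\<omega> \<in> space M. t\<^sup>2 \<le> (T \<omega>)\<^sup>2}"
  proof safe
    fix \<omega> k assume k: "k \<in> {m..n}" "t \<le> \<bar>\<Sum>i\<in>{m..<k}. \<xi> i \<omega>\<bar>"
    define P where "P k \<longleftrightarrow> k \<in> {m..n} \<and> t \<le> \<bar>\<Sum>i\<in>{m..<k}. \<xi> i \<omega>\<bar>" for k
    define K where "K = (LEAST k. P k)"
    have PK: "P K"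
      unfolding K_def by (rule LeastI[of P k]) (use k in \<open>simp add: P_def\<close>)
    have before: "\<not> P l" if "l < K" for l
      using not_less_Least that unfolding K_def by blast
    have "\<theta> i \<omega> = 1" if "i < K" for i
      using before that PK unfolding \<theta>_def P_def by (auto simp: not_le) (meson atLeastAtMost_iff le_less_trans less_imp_le_nat linorder_not_le order_trans)
    moreover have "\<theta> i \<omega> = 0" if "K \<le> i" for i
      using PK that unfolding \<theta>_def P_def by (auto simp: not_less)
    moreover have "{m..<n} = {m..<K} \<union> {K..<n}" "{m..<K} \<inter> {K..<n} = {}"
      using PK by (auto simp: P_def)
    ultimately have "T \<omega> = (\<Sum>i\<in>{m..<K}. \<xi> i \<omega>)"
      by (simp add: T_def sum.union_disjoint)
    then have "t \<le> \<bar>T \<omega>\<bar>"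
      using PK by (simp add: P_def)
    then show "t\<^sup>2 \<le> (T \<omega>)\<^sup>2"
      using power_mono[of t "\<bar>T \<omega>\<bar>" 2] assms by simp
  qed
  have "prob {\<omega> \<in> space M. \<exists>k\<in>{m..n}. t \<le> \<bar>\<Sum>i\<in>{m..<k}. \<xi> i \<omega>\<bar>}
      \<le> prob {\<omega> \<in> space M. t\<^sup>2 \<le> (T \<omega>)\<^sup>2}"
    by (intro finite_measure_mono sub) measurable
  also have "\<dots> \<le> (LINT \<omega>|M. (T \<omega>)\<^sup>2) / t\<^sup>2"
    using integral_Markov_inequality_measure[OF T(1), of "{}" "t\<^sup>2"] assms by simp
  also have "\<dots> \<le> (\<Sum>i\<in>{m..<n}. LINT \<omega>|M. (\<xi> i \<omega>)\<^sup>2) / t\<^sup>2"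
    using T(2) by (intro divide_right_mono) auto
  finally show ?thesis .
qed

lemma maximal_inequality_infinite:
  assumes "0 < t" and summ: "summable (\<lambda>i. LINT \<omega>|M. (\<xi> i \<omega>)\<^sup>2)"
  shows "prob {\<omega> \<in> space M. \<exists>k\<ge>m. t \<le> \<bar>\<Sum>i\<in>{m..<k}. \<xi> i \<omega>\<bar>}
    \<le> (\<Sum>i. LINT \<omega>|M. (\<xi> (i + m) \<omega>)\<^sup>2) / t\<^sup>2"
proof (rule LIMSEQ_le_const2)
  define A where "A n = {\<omega> \<in> space M. \<exists>k\<in>{m..n}. t \<le> \<bar>\<Sum>i\<in>{m..<k}. \<xi> i \<omega>\<bar>}" for n
  have Am: "A n \<in> sets M" for n
    unfolding A_def by measurable
  have "(\<lambda>n. prob (A n)) \<longlonglongrightarrow> prob (\<Union>n. A n)"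
  proof (rule finite_Lim_measure_incseq)
    show "range A \<subseteq> sets M" using Am by auto
    show "incseq A"
      unfolding incseq_def A_def by (auto intro: order_trans)
  qed
  also have "(\<Union>n. A n) = {\<omega> \<in> space M. \<exists>k\<ge>m. t \<le> \<bar>\<Sum>i\<in>{m..<k}. \<xi> i \<omega>\<bar>}"
    unfolding A_def by auto (metis atLeastAtMost_iff order_refl)
  finally show "(\<lambda>n. prob (A n)) \<longlonglongrightarrow> prob {\<omega> \<in> space M. \<exists>k\<ge>m. t \<le> \<bar>\<Sum>i\<in>{m..<k}. \<xi> i \<omega>\<bar>}" .
  have "prob (A n) \<le> (\<Sum>i. LINT \<omega>|M. (\<xi> (i + m) \<omega>)\<^sup>2) / t\<^sup>2" for n
  proof -
    have "prob (A n) \<le> (\<Sum>i\<in>{m..<n}. LINT \<omega>|M. (\<xi> i \<omega>)\<^sup>2) / t\<^sup>2"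
      unfolding A_def by (rule maximal_inequality[OF assms(1)])
    also have "(\<Sum>i\<in>{m..<n}. LINT \<omega>|M. (\<xi> i \<omega>)\<^sup>2) = (\<Sum>i<n - m. LINT \<omega>|M. (\<xi> (i + m) \<omega>)\<^sup>2)"
      by (rule sum.reindex_bij_witness[of _ "\<lambda>i. i + m" "\<lambda>i. i - m"]) auto
    also have "\<dots> \<le> (\<Sum>i. LINT \<omega>|M. (\<xi> (i + m) \<omega>)\<^sup>2)"
      using summ by (intro sum_le_suminf) (auto simp: summable_iff_shift[of "\<lambda>i. LINT \<omega>|M. (\<xi> i \<omega>)\<^sup>2"])
    finally show ?thesis
      by (simp add: divide_right_mono)
  qed
  then show "\<exists>N. \<forall>n\<ge>N. prob (A n) \<le> (\<Sum>i. LINT \<omega>|M. (\<xi> (i + m) \<omega>)\<^sup>2) / t\<^sup>2"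
    by blast
qed

text \<open>The maximal inequality bounds the oscillation of the partial sums beyond \<open>m\<close> by a tail of a
  convergent series, so almost surely the partial sums are Cauchy.\<close>

theorem AE_summable:
  assumes summ: "summable (\<lambda>i. LINT \<omega>|M. (\<xi> i \<omega>)\<^sup>2)"
  shows "AE \<omega> in M. summable (\<lambda>i. \<xi> i \<omega>)"
proof -
  define B where "B t m = {\<omega> \<in> space M. \<exists>k\<ge>m. t \<le> \<bar>\<Sum>i\<in>{m..<k}. \<xi> i \<omega>\<bar>}" for t :: real and m
  have Bm [measurable]: "B t m \<in> sets M" for t m
    unfolding B_def by measurable
  have "AE \<omega> in M. \<exists>m. \<omega> \<notin> B (1 / Suc r) m" for r :: nat
  proof -
    let ?l = "1 / real (Suc r)"
    have tail: "(\<lambda>m. (\<Sum>i. LINT \<omega>|M. (\<xi> (i + m) \<omega>)\<^sup>2) / ?l\<^sup>2) \<longlonglongrightarrow> 0 / ?l\<^sup>2"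
      using suminf_exist_split2[OF summ] by (intro tendsto_divide tendsto_const) auto
    have le: "prob (\<Inter>m. B ?l m) \<le> (\<Sum>i. LINT \<omega>|M. (\<xi> (i + m) \<omega>)\<^sup>2) / ?l\<^sup>2" for m
    proof -
      have "prob (\<Inter>m. B ?l m) \<le> prob (B ?l m)"
        by (intro finite_measure_mono) auto
      also have "\<dots> \<le> (\<Sum>i. LINT \<omega>|M. (\<xi> (i + m) \<omega>)\<^sup>2) / ?l\<^sup>2"
        unfolding B_def by (rule maximal_inequality_infinite[OF _ summ]) simp
      finally show ?thesis .
    qed
    have "prob (\<Inter>m. B ?l m) \<le> 0 / ?l\<^sup>2"
      by (rule LIMSEQ_le_const[OF tail]) (use le in blast)
    then have "prob (\<Inter>m. B ?l m) = 0"
      by (intro antisym measure_nonneg) simp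
    moreover have "(\<Inter>m. B ?l m) \<in> sets M"
      by measurable
    ultimately have "(\<Inter>m. B ?l m) \<in> null_sets M"
      by (simp add: null_sets_def emeasure_eq_measure)
    then show ?thesis
      by (rule AE_I') auto
  qed
  then have "AE \<omega> in M. \<forall>r. \<exists>m. \<omega> \<notin> B (1 / Suc r) m"
    by (simp add: AE_all_countable)
  with AE_space show ?thesis
  proof eventually_elim
    case (elim \<omega>)
    show "summable (\<lambda>i. \<xi> i \<omega>)"
      unfolding summable_Cauchy
    proof safe
      fix e :: real assume "0 < e"
      then obtain r where r: "1 / real (Suc r) < e / 2"
        using nat_approx_posE[of "e / 2"] by auto
      obtain m where m: "\<omega> \<notin> B (1 / Suc r) m"
        using elim by blast
      have *: "\<bar>\<Sum>i\<in>{m..<k}. \<xi> i \<omega>\<bar> < e / 2" if "k \<ge> m" for k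
      proof -
        have "\<bar>\<Sum>i\<in>{m..<k}. \<xi> i \<omega>\<bar> < 1 / real (Suc r)"
          using m elim that unfolding B_def by (simp add: not_le) (metis not_le)
        then show ?thesis
          using r by linarith
      qed
      have "norm (\<Sum>i\<in>{k..<n}. \<xi> i \<omega>) < e" if "k \<ge> m" for k n
      proof (cases "k \<le> n")
        case True
        then have "(\<Sum>i\<in>{m..<n}. \<xi> i \<omega>) = (\<Sum>i\<in>{m..<k}. \<xi> i \<omega>) + (\<Sum>i\<in>{k..<n}. \<xi> i \<omega>)"
          using that by (simp add: sum.atLeastLessThan_concat)
        moreover have "\<bar>\<Sum>i\<in>{m..<n}. \<xi> i \<omega>\<bar> < e / 2" "\<bar>\<Sum>i\<in>{m..<k}. \<xi> i \<omega>\<bar> < e / 2"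
          using *[of n] *[of k] that True by auto
        ultimately show ?thesis
          unfolding real_norm_def by linarith
      qed (use \<open>0 < e\<close> in simp)
      then show "\<exists>N. \<forall>m\<ge>N. \<forall>n. norm (sum (\<lambda>i. \<xi> i \<omega>) {m..<n}) < e"
        by blast
    qed
  qed
qed

end

section \<open>Averages and recursive inequalities\<close>

lemma cesaro_mean:
  fixes a :: "nat \<Rightarrow> real"
  assumes "a \<longlonglongrightarrow> l"
  shows "(\<lambda>n. (\<Sum>k<n. a k) / real n) \<longlonglongrightarrow> l"
proof (rule LIMSEQ_I)
  fix r :: real assume r: "0 < r"
  then obtain N where N: "\<And>n. n \<ge> N \<Longrightarrow> \<bar>a n - l\<bar> < r / 2"
    using LIMSEQ_D[OF assms, of "r / 2"] by auto
  define C where "C = (\<Sum>k<N. \<bar>a k - l\<bar>)"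
  obtain N' where N': "2 * C / r < real N'"
    using reals_Archimedean2 by blast
  have "norm ((\<Sum>k<n. a k) / real n - l) < r" if n: "n \<ge> Suc (max N N')" for n
  proof -
    have "(\<Sum>k<n. a k) / real n - l = (\<Sum>k<n. a k - l) / real n"
      using n by (simp add: sum_subtractf field_simps)
    moreover have "\<bar>\<Sum>k<n. a k - l\<bar> \<le> C + real n * (r / 2)"
    proof -
      have "\<bar>\<Sum>k<n. a k - l\<bar> \<le> (\<Sum>k<n. \<bar>a k - l\<bar>)" by (rule sum_abs)
      also have "\<dots> = C + (\<Sum>k\<in>{N..<n}. \<bar>a k - l\<bar>)"
        using n by (simp add: C_def lessThan_atLeast0 sum.atLeastLessThan_concat)
      also have "(\<Sum>k\<in>{N..<n}. \<bar>a k - l\<bar>) \<le> (\<Sum>k\<in>{N..<n}. r / 2)"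
        using N by (intro sum_mono) (auto intro: less_imp_le)
      also have "\<dots> \<le> real n * (r / 2)"
        using r by (auto intro!: mult_right_mono)
      finally show ?thesis by simp
    qed
    moreover have "C + real n * (r / 2) < real n * r"
    proof -
      have "2 * C / r < real n"
        using N' n by linarith
      then show ?thesis
        using r by (simp add: field_simps)
    qed
    ultimately show ?thesis
      using n by (simp add: field_simps)
  qed
  then show "\<exists>no. \<forall>n\<ge>no. norm ((\<Sum>k<n. a k) / real n - l) < r"
    by blast
qed

text \<open>Summation by parts expresses the mean as the partial sum of \<open>a k / (k + 1)\<close> minus the average of
  these partial sums; both have the same limit.\<close>

lemma kronecker_mean:
  fixes a :: "nat \<Rightarrow> real"
  assumes "summable (\<lambda>k. a k / real (Suc k))"
  shows "(\<lambda>n. (\<Sum>k<n. a k) / real n) \<longlonglongrightarrow> 0"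
proof -
  define s where "s n = (\<Sum>k<n. a k / real (Suc k))" for n
  obtain l where l: "s \<longlonglongrightarrow> l"
    using summable_LIMSEQ[OF assms] unfolding s_def by blast
  have "(\<Sum>k<n. a k) = real n * s n - (\<Sum>k<n. s k)" for n
  proof (induction n)
    case (Suc n)
    have "real (Suc n) * (a n / real (Suc n)) = a n"
      by simp
    moreover have "real (Suc n) * s (Suc n) = real n * s n + s n + real (Suc n) * (a n / real (Suc n))"
      by (simp add: s_def distrib_left distrib_right del: of_nat_Suc) (simp add: distrib_right)
    ultimately show ?case
      using Suc.IH by simp
  qed simp
  then have "(\<Sum>k<n. a k) / real n = s n - (\<Sum>k<n. s k) / real n" if "n > 0" for n
    using that by (simp add: diff_divide_distrib)
  moreover have "(\<lambda>n. s n - (\<Sum>k<n. s k) / real n) \<longlonglongrightarrow> l - l"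
    by (intro tendsto_diff l cesaro_mean)
  ultimately show ?thesis
    by (simp add: filterlim_cong[OF refl refl eventually_mono[OF eventually_gt_at_top[of "0::nat"]],
          of "\<lambda>n. (\<Sum>k<n. a k) / real n" "\<lambda>n. s n - (\<Sum>k<n. s k) / real n"])
qed

text \<open>The pathwise form of the Robbins-Siegmund lemma.  Once the noise \<open>x\<close> is known to have a convergent
  series, adding the partial sums of \<open>x - r\<close> to \<open>a\<close> gives a decreasing sequence, and the \<open>b n\<close> are
  dominated by its decrements.\<close>

lemma robbins_siegmund_deterministic:
  fixes a b r x :: "nat \<Rightarrow> real"
  assumes step: "\<And>n. a (Suc n) + b n + x n \<le> a n + r n"
    and b: "\<And>n. 0 \<le> b n" and a: "\<And>n. m \<le> a n" and x: "summable x" and r: "summable r"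
  shows "convergent a" "summable b"
proof -
  define p where "p n = (\<Sum>k<n. x k - r k)" for n
  define s where "s n = a n + p n" for n
  have p: "convergent p"
    using summable_diff[OF x r] unfolding p_def[abs_def] by (simp add: summable_iff_convergent)
  then obtain C where C: "\<And>n. \<bar>p n\<bar> \<le> C"
    using convergent_imp_Bseq[OF p] unfolding Bseq_def by auto
  have s_step: "s (Suc n) + b n \<le> s n" for n
    using step[of n] by (simp add: s_def p_def)
  have s_ge: "m - C \<le> s n" for n
    using a[of n] C[of n] by (simp add: s_def)
  have "decseq s"
    using s_step b by (intro decseq_SucI) (smt (verit))
  then have s: "convergent s"
    by (rule decseq_convergent[of s "m - C"]) (auto simp: s_ge convergent_def)
  have "a = (\<lambda>n. s n - p n)"
    by (simp add: s_def fun_eq_iff)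
  then show "convergent a"
    using convergent_diff[OF s p] by simp
  have "s n + (\<Sum>k<n. b k) \<le> s 0" for n
  proof (induction n)
    case (Suc n)
    then show ?case using s_step[of n] by simp
  qed simp
  then have "(\<Sum>k<n. b k) \<le> s 0 - (m - C)" for n
    using s_ge[of n] by (smt (verit))
  then show "summable b"
    by (intro bounded_imp_summable[OF b, where B = "s 0 - (m - C)"]) (metis lessThan_Suc_atMost)
qed

lemma limit_eq_0_of_harmonic:
  fixes d :: "nat \<Rightarrow> real"
  assumes d: "d \<longlonglongrightarrow> l" "\<And>n. 0 \<le> d n" and summ: "summable (\<lambda>n. (d n)\<^sup>2 / real (Suc n))"
  shows "l = 0"
proof (rule ccontr)
  assume "l \<noteq> 0"
  moreover have "0 \<le> l"
    using LIMSEQ_le_const[OF d(1)] d(2) by blast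
  ultimately have l: "0 < l" by simp
  then have "\<forall>\<^sub>F n in sequentially. l / 2 < d n"
    using order_tendstoD(1)[OF d(1), of "l / 2"] by simp
  then obtain N where N: "\<And>n. n \<ge> N \<Longrightarrow> l / 2 < d n"
    by (auto simp: eventually_sequentially)
  have "summable (\<lambda>n. (l / 2)\<^sup>2 / real (Suc n))"
  proof (rule summable_comparison_test[OF _ summ])
    have "norm ((l / 2)\<^sup>2 / real (Suc n)) \<le> (d n)\<^sup>2 / real (Suc n)" if "n \<ge> N" for n
    proof -
      have "(l / 2)\<^sup>2 \<le> (d n)\<^sup>2"
        using N[OF that] l by (intro power_mono) auto
      then show ?thesis
        by (simp add: divide_right_mono)
    qed
    then show "\<exists>N. \<forall>n\<ge>N. norm ((l / 2)\<^sup>2 / real (Suc n)) \<le> (d n)\<^sup>2 / real (Suc n)"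
      by blast
  qed
  then have "summable (\<lambda>n. (2 / l)\<^sup>2 * ((l / 2)\<^sup>2 / real (Suc n)))"
    by (rule summable_mult)
  moreover have "(2 / l)\<^sup>2 * ((l / 2)\<^sup>2 / real (Suc n)) = inverse (real (Suc n))" for n
  proof -
    have "(2 / l)\<^sup>2 * (l / 2)\<^sup>2 = 1"
      using l by (simp flip: power_mult_distrib)
    then show ?thesis
      by (metis times_divide_eq_right inverse_eq_divide)
  qed
  ultimately have "summable (\<lambda>n. inverse (real (Suc n)))"
    by simp
  then show False
    using not_summable_harmonic[where 'a = real] summable_Suc_iff[of "\<lambda>n. inverse (real n)"] by simp
qed

text \<open>The discrete counterpart of the derivative of a concave power, obtained from Young's inequality for
  \<open>n\<^sup>\<rho> (n + 1)\<^sup>1\<^sup>-\<^sup>\<rho>\<close>.  It is used to sum the step sizes.\<close>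

lemma powr_diff_ge:
  fixes \<rho> :: real
  assumes "0 < \<rho>" "\<rho> < 1"
  shows "\<rho> * (real n + 1) powr (\<rho> - 1) \<le> (real n + 1) powr \<rho> - real n powr \<rho>"
proof (cases "n = 0")
  case True
  then show ?thesis using assms by simp
next
  case False
  have "real n powr \<rho> * (real n + 1) powr (1 - \<rho>) \<le> \<rho> * real n + (1 - \<rho>) * (real n + 1)"
    using assms False by (intro Youngs_inequality_0) auto
  then have "real n powr \<rho> * (real n + 1) powr (1 - \<rho>) * (real n + 1) powr (\<rho> - 1)
      \<le> (real n + 1 - \<rho>) * (real n + 1) powr (\<rho> - 1)"
    by (intro mult_right_mono) (auto simp: algebra_simps)
  moreover have "(real n + 1) powr (1 - \<rho>) * (real n + 1) powr (\<rho> - 1) = 1"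
    by (simp flip: powr_add)
  moreover have "(real n + 1) * (real n + 1) powr (\<rho> - 1) = (real n + 1) powr \<rho>"
    using powr_add[of "real n + 1" 1 "\<rho> - 1"] by simp
  ultimately show ?thesis
    by (simp add: mult.assoc left_diff_distrib)
qed

section \<open>Projections and symmetric matrices\<close>

lemma outer_vmult: "outer a b *v u = (b \<bullet> u) *\<^sub>R (a :: real ^ 'n::finite)"
  by (simp add: vec_eq_iff outer_def matrix_vector_mult_def inner_vec_def sum_distrib_left
      sum_distrib_right algebra_simps)

lemma P_mat_vmult: "P_mat *v u = u - (v_unit \<bullet> u) *\<^sub>R v_unit"
  by (simp add: P_mat_def matrix_vector_mult_diff_rdistrib outer_vmult)

lemma v_unit_inner_self: "(v_unit :: real ^ 'n::finite) \<bullet> v_unit = 1"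
  by (simp add: v_unit_def inner_vec_def)

lemma norm_P_mat_le: "norm (P_mat *v u) \<le> norm (u :: real ^ 'n::finite)"
proof -
  have "(norm (P_mat *v u))\<^sup>2 = (norm u)\<^sup>2 - (v_unit \<bullet> u)\<^sup>2"
    unfolding power2_norm_eq_inner P_mat_vmult
    by (simp add: inner_diff_left inner_diff_right v_unit_inner_self inner_commute[of u v_unit] power2_eq_square)
  then have "(norm (P_mat *v u))\<^sup>2 \<le> (norm u)\<^sup>2"
    by simp
  then show ?thesis
    by (rule power2_le_imp_le) simp
qed

lemma v_perp_iff: "v \<in> v_perp \<longleftrightarrow> v_unit \<bullet> v = 0"
  unfolding v_perp_def orthogonal_comp_def orthogonal_def by (auto simp: span_singleton)

lemma v_perp_iff_sum: "v \<in> v_perp \<longleftrightarrow> (\<Sum>j\<in>UNIV. v $ j) = 0"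
  by (simp add: v_perp_iff v_unit_def inner_vec_def flip: sum_divide_distrib)

lemma P_mat_in_v_perp: "P_mat *v u \<in> v_perp"
  by (simp add: v_perp_iff P_mat_vmult inner_diff_right v_unit_inner_self)

lemma P_mat_id: "v \<in> v_perp \<Longrightarrow> P_mat *v v = v"
  by (simp add: v_perp_iff P_mat_vmult)

lemma matrix_mult_inv:
  fixes A :: "real ^ 'n ^ 'n::finite"
  assumes "invertible A"
  shows "A ** matrix_inv A = mat 1"
  using someI_ex[OF assms[unfolded invertible_def]] by (simp add: matrix_inv_def)

locale coercive_matrix =
  fixes A :: "real ^ 'n ^ 'n::finite" and l :: real
  assumes sym: "\<And>u v. u \<bullet> (A *v v) = (A *v u) \<bullet> v"
    and lower: "\<And>u. l * (norm u)\<^sup>2 \<le> u \<bullet> (A *v u)" and l_pos: "0 < l"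
begin

lemma invertible: "invertible A"
proof -
  have "x = 0" if "A *v x = 0" for x
    using lower[of x] l_pos that by (simp add: mult_le_0_iff)
  then show ?thesis
    unfolding invertible_left_inverse matrix_left_invertible_ker by blast
qed

lemma mult_inv: "A *v (matrix_inv A *v g) = g"
  using matrix_mult_inv[OF invertible] by (simp add: matrix_vector_mul_assoc)

lemma norm_inv_le: "norm (matrix_inv A *v g) \<le> norm g / l"
proof -
  let ?u = "matrix_inv A *v g"
  have "l * (norm ?u)\<^sup>2 \<le> ?u \<bullet> g"
    using lower[of ?u] by (simp add: mult_inv)
  also have "\<dots> \<le> norm ?u * norm g"
    by (rule norm_cauchy_schwarz)
  finally have "norm ?u * (l * norm ?u) \<le> norm ?u * norm g"
    by (simp add: power2_eq_square algebra_simps)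
  then have "l * norm ?u \<le> norm g"
    by (cases "norm ?u = 0") (auto simp: mult_le_cancel_left)
  then show ?thesis
    using l_pos by (simp add: field_simps)
qed

lemma inv_sym: "a \<bullet> (matrix_inv A *v b) = (matrix_inv A *v a) \<bullet> b"
  using sym[of "matrix_inv A *v a" "matrix_inv A *v b"] by (simp add: mult_inv)

text \<open>If \<open>A\<close> is at most \<open>L\<close>, its inverse is at least \<open>1 / L\<close>: apply positivity of the form at
  \<open>A\<^sup>-\<^sup>1 g - g / L\<close>.\<close>

lemma inv_form_ge:
  assumes upper: "\<And>u. u \<bullet> (A *v u) \<le> L * (norm u)\<^sup>2" and "0 < L"
  shows "(norm g)\<^sup>2 / L \<le> g \<bullet> (matrix_inv A *v g)"
proof -
  let ?u = "matrix_inv A *v g"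
  have "0 \<le> (?u - (1 / L) *\<^sub>R g) \<bullet> (A *v (?u - (1 / L) *\<^sub>R g))"
    using lower l_pos by (meson mult_nonneg_nonneg less_imp_le order_trans zero_le_power2)
  also have "\<dots> = ?u \<bullet> g - 2 / L * (g \<bullet> g) + (1 / L)\<^sup>2 * (g \<bullet> (A *v g))"
    using sym[of ?u g]
    by (simp add: matrix_vector_mult_diff_distrib matrix_vector_mult_scaleR mult_inv inner_diff_left
        inner_diff_right power2_eq_square algebra_simps)
  also have "\<dots> \<le> ?u \<bullet> g - 2 / L * (g \<bullet> g) + (1 / L)\<^sup>2 * (L * (norm g)\<^sup>2)"
    by (intro add_left_mono mult_left_mono upper) auto
  also have "\<dots> = ?u \<bullet> g - (norm g)\<^sup>2 / L"
    using \<open>0 < L\<close> by (simp add: power2_norm_eq_inner power2_eq_square[of "1 / L"])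
  finally show ?thesis
    by (simp add: inner_commute)
qed

end

text \<open>Cramer's rule makes measurability evident, since \<open>matrix_inv\<close> is defined by a choice operator.\<close>

lemma matrix_inv_vmult_cramer:
  fixes A :: "real ^ 'n ^ 'n::finite"
  assumes "invertible A"
  shows "(matrix_inv A *v b) $ k = det (\<chi> i j. if j = k then b $ i else A $ i $ j) / det A"
proof -
  have "A *v (matrix_inv A *v b) = b"
    using matrix_mult_inv[OF assms] by (simp add: matrix_vector_mul_assoc)
  then have "matrix_inv A *v b = (\<chi> k. det (\<chi> i j. if j = k then b $ i else A $ i $ j) / det A)"
    using assms by (subst (asm) cramer) (auto simp: invertible_det_nz)
  then show ?thesis by simp
qed

lemma inv_vmult_measurable:
  fixes A :: "'w \<Rightarrow> real ^ 'n ^ 'n::finite"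
  assumes A [measurable]: "\<And>i j. (\<lambda>\<omega>. A \<omega> $ i $ j) \<in> borel_measurable N"
    and b [measurable]: "\<And>i. (\<lambda>\<omega>. b \<omega> $ i) \<in> borel_measurable N"
    and inv: "\<And>\<omega>. invertible (A \<omega>)"
  shows "(\<lambda>\<omega>. (matrix_inv (A \<omega>) *v b \<omega>) $ k) \<in> borel_measurable N"
proof -
  have "(\<lambda>\<omega>. if j = k then b \<omega> $ i else A \<omega> $ i $ j) \<in> borel_measurable N" for i j
    by (cases "j = k") auto
  then show ?thesis
    unfolding matrix_inv_vmult_cramer[OF inv] det_def
    by (intro borel_measurable_divide borel_measurable_sum borel_measurable_times
        borel_measurable_prod borel_measurable_const A) simp_all
qed

section \<open>The log-sum-exp function\<close>

lemma ln_mean_exp_ge: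
  fixes p u :: "'j::finite \<Rightarrow> real"
  assumes p: "\<And>j. 0 < p j" "sum p UNIV = 1"
  shows "(\<Sum>j\<in>UNIV. p j * u j) \<le> ln (\<Sum>j\<in>UNIV. p j * exp (u j))"
proof -
  define m where "m = (\<Sum>j\<in>UNIV. p j * u j)"
  have "1 = (\<Sum>j\<in>UNIV. p j * (1 + (u j - m)))"
    using p(2) by (simp add: algebra_simps sum.distrib sum_subtractf m_def[symmetric] flip: sum_distrib_left)
  also have "\<dots> \<le> (\<Sum>j\<in>UNIV. p j * exp (u j - m))"
    by (intro sum_mono mult_left_mono exp_ge_add_one_self less_imp_le[OF p(1)])
  also have "\<dots> = (\<Sum>j\<in>UNIV. p j * exp (u j)) / exp m"
    by (simp add: exp_diff sum_divide_distrib)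
  finally have *: "exp m \<le> (\<Sum>j\<in>UNIV. p j * exp (u j))"
    by (simp add: field_simps)
  have "0 < (\<Sum>j\<in>UNIV. p j * exp (u j))"
    by (rule less_le_trans[OF _ *]) simp
  with * show ?thesis
    unfolding m_def[symmetric] by (simp add: ln_ge_iff)
qed

text \<open>For small \<open>t\<close> this follows from \<open>exp u \<le> 1 + u + u\<^sup>2\<close> and \<open>ln (1 + s) \<le> s\<close>.  For \<open>t > 1\<close> both
  averages lie in \<open>[-t, t]\<close>, so they differ by at most \<open>2 t \<le> 2 t\<^sup>2\<close>; hence the constant 2.\<close>

lemma ln_mean_exp_le:
  fixes p u :: "'j::finite \<Rightarrow> real"
  assumes p: "\<And>j. 0 < p j" "sum p UNIV = 1" and u: "\<And>j. \<bar>u j\<bar> \<le> t"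
  shows "ln (\<Sum>j\<in>UNIV. p j * exp (u j)) \<le> (\<Sum>j\<in>UNIV. p j * u j) + 2 * t\<^sup>2"
proof -
  have pos: "0 < (\<Sum>j\<in>UNIV. p j * exp (u j))"
    by (rule sum_pos) (auto simp: p)
  have t: "0 \<le> t"
    using u[of undefined] by linarith
  show ?thesis
  proof (cases "t \<le> 1")
    case True
    have "exp (u j) \<le> 1 + u j + t\<^sup>2" for j
    proof -
      have "exp (u j) \<le> 1 + u j + (u j)\<^sup>2"
      proof (cases "0 \<le> u j")
        case True
        then show ?thesis
          using exp_bound[of "u j"] u[of j] \<open>t \<le> 1\<close> by simp
      next
        case False
        have "exp (u j) * (1 - u j) \<le> exp (u j) * exp (- u j)"
          using exp_ge_add_one_self[of "- u j"] by (intro mult_left_mono) auto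
        then have "exp (u j) * (1 - u j) \<le> 1"
          by (simp add: exp_minus)
        moreover have "1 \<le> (1 + u j + (u j)\<^sup>2) * (1 - u j)"
        proof -
          have "(1 + u j + (u j)\<^sup>2) * (1 - u j) = 1 + (- u j)^3"
            by (simp add: algebra_simps power2_eq_square power3_eq_cube)
          then show ?thesis using False by simp
        qed
        ultimately have "exp (u j) * (1 - u j) \<le> (1 + u j + (u j)\<^sup>2) * (1 - u j)"
          by linarith
        then show ?thesis
          using False by (simp add: mult_le_cancel_right)
      qed
      also have "(u j)\<^sup>2 \<le> t\<^sup>2"
        using power_mono[OF u[of j], of 2] by simp
      finally show ?thesis by simp
    qed
    then have "(\<Sum>j\<in>UNIV. p j * exp (u j)) \<le> (\<Sum>j\<in>UNIV. p j * (1 + u j + t\<^sup>2))"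
      by (intro sum_mono mult_left_mono less_imp_le[OF p(1)]) auto
    also have "\<dots> = 1 + ((\<Sum>j\<in>UNIV. p j * u j) + t\<^sup>2)"
      by (simp add: distrib_left sum.distrib p flip: sum_distrib_right)
    finally have "ln (\<Sum>j\<in>UNIV. p j * exp (u j)) \<le> (\<Sum>j\<in>UNIV. p j * u j) + t\<^sup>2"
      using ln_le_minus_one[OF pos] by linarith
    then show ?thesis
      using zero_le_power2[of t] by linarith
  next
    case False
    have "(\<Sum>j\<in>UNIV. p j * exp (u j)) \<le> (\<Sum>j\<in>UNIV. p j * exp t)"
      using u by (intro sum_mono mult_left_mono less_imp_le[OF p(1)]) (auto simp: abs_le_iff)
    also have "\<dots> = exp t"
      by (simp add: p flip: sum_distrib_right)
    finally have "ln (\<Sum>j\<in>UNIV. p j * exp (u j)) \<le> t"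
      using pos by (metis exp_gt_zero ln_exp ln_le_cancel_iff)
    moreover have "- t \<le> (\<Sum>j\<in>UNIV. p j * u j)"
    proof -
      have "(\<Sum>j\<in>UNIV. p j * (- t)) \<le> (\<Sum>j\<in>UNIV. p j * u j)"
        using u by (intro sum_mono mult_left_mono less_imp_le[OF p(1)]) (metis abs_le_iff minus_le_iff)
      then show ?thesis
        by (simp add: p sum_negf flip: sum_distrib_right)
    qed
    moreover have "t \<le> t\<^sup>2"
      using False by (simp add: power2_eq_square)
    ultimately show ?thesis by linarith
  qed
qed

section \<open>Convexity, smoothness and growth of the semi-dual integrand\<close>

locale semi_dual =
  fixes \<mu> :: "'a::metric_space measure"
    and y :: "'j::finite \<Rightarrow> 'b::metric_space"
    and w :: "real ^ 'j"
    and c :: "'a \<Rightarrow> 'b \<Rightarrow> real"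
    and \<epsilon> :: real
  assumes prob_mu: "prob_space \<mu>" and sets_mu: "sets \<mu> = sets borel"
    and y_inj: "inj y"
    and w_pos: "\<And>j. 0 < w $ j" and w_sum: "(\<Sum>j\<in>UNIV. w $ j) = 1"
    and c_meas [measurable]: "\<And>j. (\<lambda>x. c x (y j)) \<in> borel_measurable borel"
    and c_nonneg: "\<And>x y. 0 \<le> c x y"
    and c_sq: "\<And>j. integrable \<mu> (\<lambda>x. (c x (y j))\<^sup>2)"
    and eps: "0 < \<epsilon>"
begin

sublocale mu: prob_space \<mu>
  by (rule prob_mu)

lemmas [measurable_cong] = sets_mu

abbreviation "h \<equiv> h_eps \<epsilon> c y w"
abbreviation "grad \<equiv> grad_h \<epsilon> c y w"
abbreviation "plan \<equiv> pi_vec \<epsilon> c y w"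
abbreviation "H \<equiv> H_eps \<epsilon> c y w \<mu>"

definition Zsum :: "'a \<Rightarrow> real ^ 'j \<Rightarrow> real" where
  "Zsum x v = (\<Sum>j\<in>UNIV. exp ((v $ j - c x (y j)) / \<epsilon>) * w $ j)"

lemma Zsum_pos: "0 < Zsum x v"
  unfolding Zsum_def by (rule sum_pos) (auto simp: w_pos)

lemma h_altdef: "h x v = \<epsilon> + \<epsilon> * ln (Zsum x v) - v \<bullet> w"
  by (simp add: h_eps_def Zsum_def inner_vec_def)

lemma plan_altdef: "plan x v $ j = exp ((v $ j - c x (y j)) / \<epsilon>) * w $ j / Zsum x v"
  by (simp add: pi_vec_def Zsum_def mult.commute)

lemma plan_pos: "0 < plan x v $ j"
  by (simp add: plan_altdef Zsum_pos w_pos)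

lemma plan_sum: "(\<Sum>j\<in>UNIV. plan x v $ j) = 1"
  using Zsum_pos[of x v] by (simp add: plan_altdef Zsum_def flip: sum_divide_distrib)

text \<open>Increments of \<open>h\<close> are logarithms of exponential moments under the probability vector \<open>plan x v\<close>,
  so convexity and smoothness in \<open>v\<close> reduce to the two bounds for \<open>ln_mean_exp\<close>.\<close>

lemma h_add:
  "h x (v + d) = h x v + \<epsilon> * ln (\<Sum>j\<in>UNIV. plan x v $ j * exp (d $ j / \<epsilon>)) - d \<bullet> w"
proof -
  have "Zsum x (v + d) = Zsum x v * (\<Sum>j\<in>UNIV. plan x v $ j * exp (d $ j / \<epsilon>))"
    using Zsum_pos[of x v]
    by (simp add: plan_altdef sum_distrib_left)
      (simp add: Zsum_def algebra_simps add_divide_distrib diff_divide_distrib exp_add exp_diff)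
  moreover have "0 < (\<Sum>j\<in>UNIV. plan x v $ j * exp (d $ j / \<epsilon>))"
    by (rule sum_pos) (auto simp: plan_pos)
  ultimately have "ln (Zsum x (v + d)) = ln (Zsum x v) + ln (\<Sum>j\<in>UNIV. plan x v $ j * exp (d $ j / \<epsilon>))"
    using Zsum_pos[of x v] by (simp add: ln_mult)
  then show ?thesis
    by (simp add: h_altdef algebra_simps inner_add_left)
qed

lemma grad_inner: "grad x v \<bullet> d = \<epsilon> * (\<Sum>j\<in>UNIV. plan x v $ j * (d $ j / \<epsilon>)) - d \<bullet> w"
  using eps by (simp add: grad_h_def inner_vec_def sum_distrib_left algebra_simps sum_subtractf)

lemma h_convex: "h x v + grad x v \<bullet> d \<le> h x (v + d)"
  using ln_mean_exp_ge[OF plan_pos plan_sum, of x v "\<lambda>j. d $ j / \<epsilon>"] eps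
  by (simp add: h_add grad_inner)

lemma h_smooth: "h x (v + d) \<le> h x v + grad x v \<bullet> d + 2 / \<epsilon> * (norm d)\<^sup>2"
proof -
  have "\<bar>d $ j / \<epsilon>\<bar> \<le> norm d / \<epsilon>" for j
    using component_le_norm_cart[of d j] eps by (simp add: divide_right_mono)
  from ln_mean_exp_le[OF plan_pos plan_sum this, of x v]
  have "\<epsilon> * ln (\<Sum>j\<in>UNIV. plan x v $ j * exp (d $ j / \<epsilon>))
      \<le> \<epsilon> * ((\<Sum>j\<in>UNIV. plan x v $ j * (d $ j / \<epsilon>)) + 2 * (norm d / \<epsilon>)\<^sup>2)"
    using eps by (intro mult_left_mono) auto
  also have "\<epsilon> * (2 * (norm d / \<epsilon>)\<^sup>2) = 2 / \<epsilon> * (norm d)\<^sup>2"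
    using eps by (simp add: power2_eq_square)
  then have "\<epsilon> * ((\<Sum>j\<in>UNIV. plan x v $ j * (d $ j / \<epsilon>)) + 2 * (norm d / \<epsilon>)\<^sup>2)
     = \<epsilon> * (\<Sum>j\<in>UNIV. plan x v $ j * (d $ j / \<epsilon>)) + 2 / \<epsilon> * (norm d)\<^sup>2"
    by (simp add: distrib_left)
  finally show ?thesis
    by (simp add: h_add grad_inner)
qed

lemma norm_w_le: "norm w \<le> 1"
  using norm_le_l1_cart[of w] w_sum by (simp add: less_imp_le[OF w_pos])

lemma norm_grad_le: "norm (grad x v) \<le> 2"
proof -
  have "norm (plan x v) \<le> 1"
    using norm_le_l1_cart[of "plan x v"] plan_sum[of x v] by (simp add: less_imp_le[OF plan_pos])
  then show ?thesis
    using norm_triangle_ineq4[of "plan x v" w] norm_w_le by (simp add: grad_h_def)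
qed

lemma grad_perp: "grad x v \<bullet> v_unit = 0"
  by (simp add: grad_h_def inner_vec_def v_unit_def sum_subtractf plan_sum w_sum
      flip: sum_divide_distrib)

definition cost_sum :: "'a \<Rightarrow> real" where
  "cost_sum x = (\<Sum>j\<in>UNIV. c x (y j))"

lemma cost_sum_ge: "c x (y j) \<le> cost_sum x"
  unfolding cost_sum_def by (rule member_le_sum) (auto simp: c_nonneg)

definition Kh :: real where
  "Kh = \<epsilon> + \<epsilon> * (\<Sum>j\<in>UNIV. \<bar>ln (w $ j)\<bar>)"

text \<open>Keep a single summand of the log-sum-exp.\<close>

lemma h_ge: "v $ j - v \<bullet> w - cost_sum x - Kh \<le> h x v"
proof -
  have "exp ((v $ j - c x (y j)) / \<epsilon>) * w $ j \<le> Zsum x v"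
    unfolding Zsum_def by (rule member_le_sum) (auto simp: less_imp_le[OF w_pos])
  then have "ln (exp ((v $ j - c x (y j)) / \<epsilon>) * w $ j) \<le> ln (Zsum x v)"
    using w_pos[of j] Zsum_pos[of x v] by (subst ln_le_cancel_iff) auto
  then have "(v $ j - c x (y j)) / \<epsilon> + ln (w $ j) \<le> ln (Zsum x v)"
    using w_pos[of j] by (simp add: ln_mult)
  then have "\<epsilon> * ((v $ j - c x (y j)) / \<epsilon> + ln (w $ j)) \<le> \<epsilon> * ln (Zsum x v)"
    using eps by simp
  then have 1: "v $ j - c x (y j) + \<epsilon> * ln (w $ j) \<le> \<epsilon> * ln (Zsum x v)"
    using eps by (simp add: distrib_left)
  have "\<bar>ln (w $ j)\<bar> \<le> (\<Sum>j\<in>UNIV. \<bar>ln (w $ j)\<bar>)"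
    by (rule member_le_sum) auto
  then have "- (\<Sum>j\<in>UNIV. \<bar>ln (w $ j)\<bar>) \<le> ln (w $ j)" by linarith
  then have "\<epsilon> * (- (\<Sum>j\<in>UNIV. \<bar>ln (w $ j)\<bar>)) \<le> \<epsilon> * ln (w $ j)"
    using eps by (intro mult_left_mono) auto
  then show ?thesis
    using 1 cost_sum_ge[of x j] eps by (simp add: h_altdef Kh_def)
qed

lemma abs_h_le: "\<bar>h x v\<bar> \<le> Kh + 2 * norm v + cost_sum x"
proof -
  have vw: "\<bar>v \<bullet> w\<bar> \<le> norm v"
    using Cauchy_Schwarz_ineq2[of v w] mult_left_mono[OF norm_w_le, of "norm v"] by simp
  have vj: "\<bar>v $ j\<bar> \<le> norm v" for j
    by (rule component_le_norm_cart)
  have "Zsum x v \<le> (\<Sum>j\<in>UNIV. exp (norm v / \<epsilon>) * w $ j)"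
    unfolding Zsum_def
  proof (intro sum_mono mult_right_mono)
    fix j
    have "v $ j - c x (y j) \<le> norm v"
      using vj[of j] c_nonneg[of x "y j"] by linarith
    then show "exp ((v $ j - c x (y j)) / \<epsilon>) \<le> exp (norm v / \<epsilon>)"
      using eps by (simp add: divide_right_mono)
  qed (auto simp: less_imp_le[OF w_pos])
  also have "\<dots> = exp (norm v / \<epsilon>)"
    by (simp add: w_sum flip: sum_distrib_left)
  finally have "ln (Zsum x v) \<le> norm v / \<epsilon>"
    using Zsum_pos[of x v] by (metis exp_gt_zero ln_exp ln_le_cancel_iff)
  then have "\<epsilon> * ln (Zsum x v) \<le> norm v"
    using eps by (simp add: field_simps)
  then have "h x v \<le> \<epsilon> + 2 * norm v"
    using vw by (simp add: h_altdef)
  moreover have "\<epsilon> \<le> Kh"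
    unfolding Kh_def using eps by (simp add: sum_nonneg)
  moreover have "0 \<le> cost_sum x"
    unfolding cost_sum_def by (simp add: sum_nonneg c_nonneg)
  moreover have "- (2 * norm v) \<le> v $ undefined - v \<bullet> w"
    using vw vj[of undefined] by linarith
  ultimately show ?thesis
    using h_ge[of v undefined x] by linarith
qed

text \<open>Choose the coordinate \<open>i\<close> where \<open>v\<close> is maximal in \<open>h_ge\<close>.  Then \<open>v $ i - v \<bullet> w\<close> is the \<open>w\<close>-average
  of the gaps \<open>v $ i - v $ k\<close>, hence at least \<open>m\<close> times each gap; as the coordinates of \<open>v\<close> sum to
  zero, the largest gap dominates every absolute value.\<close>

lemma h_coercive:
  assumes m: "\<And>j. m \<le> w $ j" "0 < m" and v: "v \<in> v_perp"
  shows "m / real CARD('j) * norm v - cost_sum x - Kh \<le> h x v"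
proof -
  obtain i where i: "\<And>k. v $ k \<le> v $ i"
  proof -
    obtain i where "v $ i = Max (range (($) v))"
      using Max_in[of "range (($) v)"] by (metis finite finite_imageI image_iff image_is_empty UNIV_not_empty)
    then show thesis
      using that[of i] by simp
  qed
  have "m * norm v \<le> m * (\<Sum>k\<in>UNIV. \<bar>v $ k\<bar>)"
    using norm_le_l1_cart m(2) by (intro mult_left_mono) auto
  also have "\<dots> \<le> (\<Sum>k::'j\<in>UNIV. v $ i - v \<bullet> w)"
    unfolding sum_distrib_left
  proof (rule sum_mono)
    fix k :: 'j
    have sum0: "(\<Sum>j\<in>UNIV. v $ j) = 0"
      using v by (simp add: v_perp_iff_sum)
    have vi: "0 \<le> v $ i"
      using sum_bounded_above[of "UNIV::'j set" "($) v" "v $ i"] i sum0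
      by (simp add: zero_le_mult_iff)
    have *: "m * (v $ i - v $ l) \<le> v $ i - v \<bullet> w" for l
    proof -
      have "m * (v $ i - v $ l) \<le> w $ l * (v $ i - v $ l)"
        using i m by (intro mult_right_mono) auto
      also have "\<dots> \<le> (\<Sum>k\<in>UNIV. w $ k * (v $ i - v $ k))"
        by (rule member_le_sum) (auto simp: i less_imp_le[OF w_pos])
      also have "\<dots> = v $ i - v \<bullet> w"
        by (simp add: algebra_simps sum_subtractf inner_vec_def w_sum flip: sum_distrib_left)
      finally show ?thesis .
    qed
    obtain l where l: "v $ l \<le> 0"
    proof (rule ccontr)
      assume "\<not> thesis"
      then have "0 < (\<Sum>j\<in>UNIV. v $ j)"
        by (intro sum_pos) (use that in \<open>auto simp: not_le[symmetric]\<close>)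
      then show False by (simp add: sum0)
    qed
    show "m * \<bar>v $ k\<bar> \<le> v $ i - v \<bullet> w"
    proof (cases "0 \<le> v $ k")
      case True
      have "m * \<bar>v $ k\<bar> \<le> m * (v $ i - v $ l)"
        using True i[of k] l m by (intro mult_left_mono) auto
      then show ?thesis using *[of l] by linarith
    next
      case False
      have "m * \<bar>v $ k\<bar> \<le> m * (v $ i - v $ k)"
        using False vi m by (intro mult_left_mono) auto
      then show ?thesis using *[of k] by linarith
    qed
  qed
  finally have "m * norm v / real CARD('j) \<le> v $ i - v \<bullet> w"
    by (simp add: field_simps)
  then show ?thesis
    using h_ge[of v i x] by simp
qed

section \<open>The semi-dual objective and its gradient\<close>

definition gradH :: "real ^ 'j \<Rightarrow> real ^ 'j" where
  "gradH v = (LINT x|\<mu>. grad x v)"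

lemma nth_measurable [measurable (raw)]:
  "f \<in> borel_measurable N \<Longrightarrow> (\<lambda>z. (f z :: real ^ 'j) $ j) \<in> borel_measurable N"
  by (rule measurable_compose[OF _ borel_measurable_continuous_onI[OF
        linear_continuous_on[OF bounded_linear_vec_nth]]])

lemma vec_measurableI:
  fixes f :: "'z \<Rightarrow> real ^ 'j"
  assumes "\<And>j. (\<lambda>z. f z $ j) \<in> borel_measurable N"
  shows "f \<in> borel_measurable N"
  using assms by (subst borel_measurable_euclidean_space) (auto simp: Basis_vec_def inner_axis)

lemma c_measurable [measurable (raw)]:
  "X \<in> measurable N borel \<Longrightarrow> (\<lambda>z. c (X z) (y j)) \<in> borel_measurable N"
  using measurable_compose[OF _ c_meas] .

lemma h_measurable [measurable (raw)]:
  assumes [measurable]: "X \<in> measurable N borel" "v \<in> borel_measurable N"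
  shows "(\<lambda>z. h (X z) (v z)) \<in> borel_measurable N"
  unfolding h_eps_def by measurable

lemma grad_measurable [measurable (raw)]:
  assumes [measurable]: "X \<in> measurable N borel" "v \<in> borel_measurable N"
  shows "(\<lambda>z. grad (X z) (v z)) \<in> borel_measurable N"
  by (rule vec_measurableI) (simp add: grad_h_def pi_vec_def)

lemma Zsum_measurable [measurable (raw)]:
  assumes [measurable]: "X \<in> measurable N borel"
  shows "(\<lambda>z. Zsum (X z) v) \<in> borel_measurable N"
  unfolding Zsum_def by measurable

lemma cost_sum_measurable [measurable (raw)]:
  assumes [measurable]: "X \<in> measurable N borel"
  shows "(\<lambda>z. cost_sum (X z)) \<in> borel_measurable N"
  unfolding cost_sum_def by measurable

lemma id_measurable_mu [measurable]: "(\<lambda>x. x) \<in> measurable \<mu> borel"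
  using sets_mu by (simp add: measurable_def sets_eq_imp_space_eq[OF sets_mu])

lemma integrable_cost: "integrable \<mu> (\<lambda>x. c x (y j))"
  by (rule mu.square_integrable_imp_integrable[OF _ c_sq]) measurable

lemma integrable_cost_sum: "integrable \<mu> cost_sum"
  unfolding cost_sum_def[abs_def] by (intro Bochner_Integration.integrable_sum integrable_cost)

lemma integrable_cost_sum_sq: "integrable \<mu> (\<lambda>x. (cost_sum x)\<^sup>2)"
proof (rule Bochner_Integration.integrable_bound)
  show "integrable \<mu> (\<lambda>x. real CARD('j) * (\<Sum>j\<in>UNIV. (c x (y j))\<^sup>2))"
    by (intro integrable_mult_right Bochner_Integration.integrable_sum c_sq)
  show "AE x in \<mu>. norm ((cost_sum x)\<^sup>2) \<le> norm (real CARD('j) * (\<Sum>j\<in>UNIV. (c x (y j))\<^sup>2))"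
  proof (rule AE_I2)
    fix x
    show "norm ((cost_sum x)\<^sup>2) \<le> norm (real CARD('j) * (\<Sum>j\<in>UNIV. (c x (y j))\<^sup>2))"
      using sum_squared_le_sum_of_squares[of "\<lambda>j. c x (y j)" "UNIV :: 'j set"]
      by (simp add: cost_sum_def sum_nonneg mult.commute)
  qed
qed measurable

lemma integrable_h: "integrable \<mu> (\<lambda>x. h x v)"
proof (rule Bochner_Integration.integrable_bound)
  show "integrable \<mu> (\<lambda>x. Kh + 2 * norm v + cost_sum x)"
    by (intro Bochner_Integration.integrable_add integrable_cost_sum) auto
  show "AE x in \<mu>. norm (h x v) \<le> norm (Kh + 2 * norm v + cost_sum x)"
    using order_trans[OF abs_h_le[of _ v] abs_ge_self] by simp
qed measurable

lemma integrable_grad: "integrable \<mu> (\<lambda>x. grad x v)"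
  by (rule mu.integrable_const_bound[of _ 2]) (auto simp: norm_grad_le)

lemma gradH_inner: "gradH v \<bullet> d = (LINT x|\<mu>. grad x v \<bullet> d)"
  unfolding gradH_def by (rule integral_inner_left[symmetric]) (simp add: integrable_grad)

lemma norm_gradH_le: "norm (gradH v) \<le> 2"
proof -
  have "norm (gradH v) \<le> (LINT x|\<mu>. norm (grad x v))"
    unfolding gradH_def by (rule integral_norm_bound)
  also have "\<dots> \<le> (LINT x|\<mu>. 2)"
    by (intro integral_mono integrable_norm integrable_grad norm_grad_le) auto
  finally show ?thesis by (simp add: mu.prob_space)
qed

lemma gradH_perp: "gradH v \<bullet> v_unit = 0"
  by (simp add: gradH_inner grad_perp)

lemma H_convex: "H v + gradH v \<bullet> d \<le> H (v + d)"
proof -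
  have "H v + gradH v \<bullet> d = (LINT x|\<mu>. h x v + grad x v \<bullet> d)"
    unfolding H_eps_def gradH_inner
    by (intro Bochner_Integration.integral_add[symmetric] integrable_h integrable_inner_left integrable_grad)
  also have "\<dots> \<le> H (v + d)"
    unfolding H_eps_def
    by (intro integral_mono Bochner_Integration.integrable_add integrable_h integrable_inner_left
        integrable_grad h_convex)
  finally show ?thesis .
qed

lemma H_smooth: "H (v + d) \<le> H v + gradH v \<bullet> d + 2 / \<epsilon> * (norm d)\<^sup>2"
proof -
  have i: "integrable \<mu> (\<lambda>x. h x v + grad x v \<bullet> d)"
    by (intro Bochner_Integration.integrable_add integrable_h integrable_inner_left integrable_grad)
  have "H (v + d) \<le> (LINT x|\<mu>. h x v + grad x v \<bullet> d + 2 / \<epsilon> * (norm d)\<^sup>2)"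
    unfolding H_eps_def
    by (intro integral_mono Bochner_Integration.integrable_add integrable_h integrable_inner_left
        integrable_grad h_smooth) auto
  also have "\<dots> = (LINT x|\<mu>. h x v + grad x v \<bullet> d) + 2 / \<epsilon> * (norm d)\<^sup>2"
    by (subst Bochner_Integration.integral_add[OF i]) (auto simp: mu.prob_space)
  also have "(LINT x|\<mu>. h x v + grad x v \<bullet> d) = H v + gradH v \<bullet> d"
    unfolding H_eps_def gradH_inner
    by (intro Bochner_Integration.integral_add integrable_h integrable_inner_left integrable_grad)
  finally show ?thesis .
qed

text \<open>The quadratic upper bound of \<open>H_smooth\<close> along the negative gradient is minimal at the step length
  \<open>\<epsilon> / 4\<close>, and a nonzero gradient would strictly decrease \<open>H\<close> there.\<close>

lemma gradH_eq_0:
  assumes "\<And>v. H u \<le> H v"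
  shows "gradH u = 0"
proof -
  define t where "t = \<epsilon> / 4"
  have "H u \<le> H (u + (- t) *\<^sub>R gradH u)"
    by (rule assms)
  also have "\<dots> \<le> H u + gradH u \<bullet> ((- t) *\<^sub>R gradH u) + 2 / \<epsilon> * (norm ((- t) *\<^sub>R gradH u))\<^sup>2"
    by (rule H_smooth)
  also have "\<dots> = H u - \<epsilon> / 8 * (norm (gradH u))\<^sup>2"
    using eps by (simp add: t_def power_mult_distrib power2_norm_eq_inner) (simp add: field_simps power2_eq_square dot_square_norm)
  finally have "\<epsilon> / 8 * (norm (gradH u))\<^sup>2 \<le> 0" by simp
  then show ?thesis
    using eps by (simp add: mult_le_0_iff)
qed

lemma H_coercive:
  obtains a b where "0 < a" "\<And>v. v \<in> v_perp \<Longrightarrow> a * norm v \<le> H v + b"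
proof
  define m where "m = Min (range (($) w))"
  have m: "m \<le> w $ j" for j
    by (simp add: m_def)
  have m0: "0 < m"
    by (simp add: m_def w_pos)
  show "0 < m / real CARD('j)"
    using m0 by simp
  fix v :: "real ^ 'j" assume v: "v \<in> v_perp"
  have "(LINT x|\<mu>. m / real CARD('j) * norm v - cost_sum x - Kh) \<le> H v"
    unfolding H_eps_def
    by (intro integral_mono Bochner_Integration.integrable_diff integrable_h integrable_cost_sum
        h_coercive[OF m m0 v]) auto
  also have "(LINT x|\<mu>. m / real CARD('j) * norm v - cost_sum x - Kh)
      = m / real CARD('j) * norm v - (LINT x|\<mu>. cost_sum x) - Kh"
    by (simp add: integrable_cost_sum mu.prob_space)
  finally show "m / real CARD('j) * norm v \<le> H v + ((LINT x|\<mu>. cost_sum x) + Kh)"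
    by simp
qed

section \<open>Semi-duality\<close>

abbreviation "\<nu> \<equiv> discrete_measure y w"

lemma sets_nu [measurable_cong]: "sets \<nu> = sets borel"
  by (simp add: discrete_measure_def)

lemma space_nu: "space \<nu> = UNIV"
  by (simp add: discrete_measure_def)

lemma nn_integral_nu:
  assumes "f \<in> borel_measurable borel"
  shows "(\<integral>\<^sup>+z. f z \<partial>\<nu>) = (\<Sum>j\<in>UNIV. ennreal (w $ j) * f (y j))"
  unfolding discrete_measure_def using assms
  by (subst nn_integral_distr) (auto simp: point_measure_def nn_integral_count_space_finite nn_integral_density)

lemma prob_nu: "prob_space \<nu>"
proof
  have "emeasure \<nu> UNIV = (\<Sum>j\<in>UNIV. ennreal (w $ j))"
    by (simp add: emeasure_discrete_measure)
  also have "\<dots> = 1"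
    by (simp add: sum_ennreal less_imp_le[OF w_pos] w_sum)
  finally show "emeasure \<nu> (space \<nu>) = 1"
    by (simp add: space_nu)
qed

sublocale nu: prob_space \<nu>
  by (rule prob_nu)

sublocale munu: pair_prob_space \<mu> \<nu> ..

lemma nn_integral_munu:
  assumes [measurable]: "f \<in> borel_measurable (\<mu> \<Otimes>\<^sub>M \<nu>)"
  shows "(\<integral>\<^sup>+z. f z \<partial>(\<mu> \<Otimes>\<^sub>M \<nu>)) = (\<integral>\<^sup>+x. (\<Sum>j\<in>UNIV. ennreal (w $ j) * f (x, y j)) \<partial>\<mu>)"
proof -
  have "(\<integral>\<^sup>+z. f z \<partial>(\<mu> \<Otimes>\<^sub>M \<nu>)) = (\<integral>\<^sup>+x. (\<integral>\<^sup>+z. f (x, z) \<partial>\<nu>) \<partial>\<mu>)"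
    by (rule nu.nn_integral_fst[symmetric]) measurable
  also have "\<dots> = (\<integral>\<^sup>+x. (\<Sum>j\<in>UNIV. ennreal (w $ j) * f (x, y j)) \<partial>\<mu>)"
  proof (intro nn_integral_cong nn_integral_nu)
    fix x assume "x \<in> space \<mu>"
    then have "(\<lambda>z. f (x, z)) \<in> borel_measurable \<nu>"
      by measurable
    then show "(\<lambda>z. f (x, z)) \<in> borel_measurable borel"
      by (simp add: measurable_cong_sets[OF sets_nu refl])
  qed
  finally show ?thesis .
qed

text \<open>The cost, made measurable on the product by setting it to zero off the slices at the atoms.\<close>

definition slice_cost :: "'a \<times> 'b \<Rightarrow> real" where
  "slice_cost z = (\<Sum>j\<in>UNIV. indicator {y j} (snd z) * c (fst z) (y j))"

text \<open>The dual vector as a function on the second space.\<close>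

definition pot :: "real ^ 'j \<Rightarrow> 'b \<Rightarrow> real" where
  "pot v z = (\<Sum>j\<in>UNIV. indicator {y j} z * v $ j)"

text \<open>The logarithm of the density, with respect to the product measure, of the Gibbs plan with dual
  vector \<open>v\<close>.\<close>

definition logdens :: "real ^ 'j \<Rightarrow> 'a \<times> 'b \<Rightarrow> real" where
  "logdens v z = (pot v (snd z) - slice_cost z) / \<epsilon> - ln (Zsum (fst z) v)"

lemma slice_cost_y: "slice_cost (x, y j) = c x (y j)"
  using y_inj by (simp add: slice_cost_def indicator_def inj_eq if_distrib[of "\<lambda>t. t * _"] cong: if_cong)

lemma pot_y: "pot v (y j) = v $ j"
  using y_inj by (simp add: pot_def indicator_def inj_eq if_distrib[of "\<lambda>t. t * _"] cong: if_cong)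

lemma slice_cost_nonneg: "0 \<le> slice_cost z"
  by (simp add: slice_cost_def sum_nonneg c_nonneg)

lemma slice_cost_le: "slice_cost z \<le> cost_sum (fst z)"
  unfolding slice_cost_def cost_sum_def
  by (intro sum_mono) (auto simp: indicator_def c_nonneg)

lemma pot_bounded: "\<bar>pot v z\<bar> \<le> (\<Sum>j\<in>UNIV. \<bar>v $ j\<bar>)"
  unfolding pot_def by (rule order_trans[OF sum_abs]) (auto intro!: sum_mono simp: indicator_def)

lemma slice_cost_measurable [measurable]: "slice_cost \<in> borel_measurable (\<mu> \<Otimes>\<^sub>M \<nu>)"
  unfolding slice_cost_def[abs_def] by measurable

lemma pot_measurable [measurable]: "pot v \<in> borel_measurable borel"
  unfolding pot_def[abs_def] by measurable

lemma logdens_measurable [measurable]: "logdens v \<in> borel_measurable (\<mu> \<Otimes>\<^sub>M \<nu>)"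
  unfolding logdens_def[abs_def] by measurable

lemma exp_logdens: "w $ j * exp (logdens v (x, y j)) = plan x v $ j"
  using Zsum_pos[of x v]
  by (simp add: logdens_def slice_cost_y pot_y exp_diff plan_altdef mult.commute)

lemma nn_integral_exp_logdens:
  assumes [measurable]: "f \<in> borel_measurable (\<mu> \<Otimes>\<^sub>M \<nu>)"
  shows "(\<integral>\<^sup>+z. ennreal (exp (logdens v z)) * f z \<partial>(\<mu> \<Otimes>\<^sub>M \<nu>))
    = (\<integral>\<^sup>+x. (\<Sum>j\<in>UNIV. ennreal (plan x v $ j) * f (x, y j)) \<partial>\<mu>)"
proof -
  have "ennreal (w $ j) * (ennreal (exp (logdens v (x, y j))) * f (x, y j))
      = ennreal (plan x v $ j) * f (x, y j)" for x j
    by (simp add: mult.assoc[symmetric] exp_logdens less_imp_le[OF w_pos] flip: ennreal_mult)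
  then show ?thesis
    by (subst nn_integral_munu) auto
qed

lemma integrable_ln_Zsum: "integrable \<mu> (\<lambda>x. ln (Zsum x v))"
proof -
  have "ln (Zsum x v) = (h x v - \<epsilon> + v \<bullet> w) / \<epsilon>" for x
    using eps by (simp add: h_altdef)
  then show ?thesis
    by (simp add: integrable_h)
qed

lemma H_altdef: "H v = \<epsilon> + \<epsilon> * (LINT x|\<mu>. ln (Zsum x v)) - v \<bullet> w"
  unfolding H_eps_def by (simp add: h_altdef integrable_ln_Zsum mu.prob_space)

context
  fixes \<pi> :: "('a \<times> 'b) measure"
  assumes coupling: "\<pi> \<in> couplings \<mu> \<nu>"
begin

lemma sets_coupling [measurable_cong]: "sets \<pi> = sets (\<mu> \<Otimes>\<^sub>M \<nu>)"
  using coupling by (simp add: couplings_def)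

lemma distr_fst_coupling: "distr \<pi> \<mu> fst = \<mu>"
  using coupling by (simp add: couplings_def)

lemma distr_snd_coupling: "distr \<pi> \<nu> snd = \<nu>"
  using coupling by (simp add: couplings_def)

lemma prob_space_coupling: "prob_space \<pi>"
  by (rule prob_space_distrD[of fst \<pi> \<mu>]) (measurable, simp add: distr_fst_coupling mu.prob_space_axioms)

lemma integral_fst_coupling:
  fixes f :: "'a \<Rightarrow> real"
  assumes "integrable \<mu> f"
  shows "integrable \<pi> (\<lambda>z. f (fst z))" "(LINT z|\<pi>. f (fst z)) = (LINT x|\<mu>. f x)"
proof -
  have m: "fst \<in> measurable \<pi> \<mu>"
    by measurable
  have f: "f \<in> borel_measurable \<mu>"
    using assms by auto
  show "integrable \<pi> (\<lambda>z. f (fst z))"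
    using integrable_distr_eq[OF m f] assms by (simp add: distr_fst_coupling)
  show "(LINT z|\<pi>. f (fst z)) = (LINT x|\<mu>. f x)"
    using integral_distr[OF m f] by (simp add: distr_fst_coupling)
qed

lemma integral_pot_coupling:
  "integrable \<pi> (\<lambda>z. pot v (snd z))" "(LINT z|\<pi>. pot v (snd z)) = v \<bullet> w"
proof -
  interpret pi: prob_space \<pi>
    by (rule prob_space_coupling)
  show "integrable \<pi> (\<lambda>z. pot v (snd z))"
    using pot_bounded by (intro pi.integrable_const_bound[of _ "\<Sum>j\<in>UNIV. \<bar>v $ j\<bar>"]) auto
  have m: "snd \<in> measurable \<pi> \<nu>"
    by measurable
  have yj: "measure \<nu> {y j} = w $ j" for j
    using y_inj by (simp add: measure_def emeasure_discrete_measure indicator_def inj_eq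
        if_distrib[of "\<lambda>t. _ * t"] less_imp_le[OF w_pos] cong: if_cong)
  have "(LINT z|\<pi>. pot v (snd z)) = (LINT z|\<nu>. pot v z)"
    using integral_distr[OF m, of "pot v"] by (simp add: distr_snd_coupling)
  also have "\<dots> = (\<Sum>j\<in>UNIV. (LINT z|\<nu>. indicator {y j} z * v $ j))"
    unfolding pot_def by (rule Bochner_Integration.integral_sum)
      (auto intro!: integrable_mult_left integrable_real_indicator simp: nu.emeasure_eq_measure)
  also have "\<dots> = v \<bullet> w"
    by (simp add: yj inner_vec_def mult.commute space_nu)
  finally show "(LINT z|\<pi>. pot v (snd z)) = v \<bullet> w" .
qed

lemma integrable_slice_cost: "integrable \<pi> slice_cost"
proof (rule Bochner_Integration.integrable_bound[OF integral_fst_coupling(1)[OF integrable_cost_sum]])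
  show "AE z in \<pi>. norm (slice_cost z) \<le> norm (cost_sum (fst z))"
    using slice_cost_le slice_cost_nonneg by (auto intro!: AE_I2 simp: order_trans[OF _ abs_ge_self])
qed measurable

text \<open>Couplings are carried by the slices at the atoms, and the nonnegative integral of a possibly
  nonmeasurable function does not see null sets.\<close>

lemma nn_integral_cost_coupling:
  "(\<integral>\<^sup>+z. ennreal (c (fst z) (snd z)) \<partial>\<pi>) = ennreal (LINT z|\<pi>. slice_cost z)"
proof -
  have "AE z in \<nu>. z \<in> range y"
  proof (rule AE_I)

    show "{z \<in> space \<nu>. z \<notin> range y} \<subseteq> - range y" by auto
    have "open (- range y)"
      by (intro open_Compl finite_imp_closed) simp
    then show "- range y \<in> sets \<nu>"
      by (simp add: sets_nu)
    then show "emeasure \<nu> (- range y) = 0"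
      by (simp add: sets_nu emeasure_discrete_measure)
  qed
  then have "AE z in distr \<pi> \<nu> snd. z \<in> range y"
    unfolding distr_snd_coupling .
  moreover have "snd \<in> measurable \<pi> \<nu>"
    by measurable
  ultimately have "AE z in \<pi>. snd z \<in> range y"
    using AE_distrD[of snd \<pi> \<nu> "\<lambda>z. z \<in> range y"] by blast
  then have "(\<integral>\<^sup>+z. ennreal (c (fst z) (snd z)) \<partial>\<pi>) = (\<integral>\<^sup>+z. ennreal (slice_cost z) \<partial>\<pi>)"
    by (intro nn_integral_cong_AE) (auto elim!: eventually_mono simp: slice_cost_y)
  also have "\<dots> = ennreal (LINT z|\<pi>. slice_cost z)"
    by (rule nn_integral_eq_integral) (auto simp: integrable_slice_cost slice_cost_nonneg)
  finally show ?thesis .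
qed

lemma logdens_coupling:
  "integrable \<pi> (logdens v)"
  "\<epsilon> * ((LINT z|\<pi>. logdens v z) - 1) = - H v - (LINT z|\<pi>. slice_cost z)"
proof -
  note i = integral_pot_coupling(1)[of v] integrable_slice_cost
    integral_fst_coupling(1)[OF integrable_ln_Zsum[of v]]
  show "integrable \<pi> (logdens v)"
    unfolding logdens_def[abs_def]
    by (intro Bochner_Integration.integrable_diff integrable_divide_zero i)
  have "(LINT z|\<pi>. logdens v z)
     = (v \<bullet> w - (LINT z|\<pi>. slice_cost z)) / \<epsilon> - (LINT x|\<mu>. ln (Zsum x v))"
    unfolding logdens_def
    by (subst Bochner_Integration.integral_diff)
      (auto simp: i integral_pot_coupling(2) integral_fst_coupling(2)[OF integrable_ln_Zsum[of v]])
  then have "\<epsilon> * (LINT z|\<pi>. logdens v z)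
     = v \<bullet> w - (LINT z|\<pi>. slice_cost z) - \<epsilon> * (LINT x|\<mu>. ln (Zsum x v))"
    using eps by (simp add: right_diff_distrib diff_divide_distrib)
  then show "\<epsilon> * ((LINT z|\<pi>. logdens v z) - 1) = - H v - (LINT z|\<pi>. slice_cost z)"
    by (simp add: H_altdef right_diff_distrib)
qed

text \<open>With \<open>r\<close> the density of the coupling and \<open>a\<close> the Gibbs log-density, \<open>ln s \<le> s - 1\<close> at
  \<open>s = exp a / r\<close> gives \<open>a - (ln r - 1) \<le> exp a / r\<close>.  The integral of the right-hand side under
  the coupling is at most 1, because \<open>exp a\<close> is a probability density; the integral of \<open>a\<close> is
  explicit because it only depends on the marginals and the transport cost.\<close>

lemma weak_duality:
  "ereal (- H v) \<le> enn2ereal (\<integral>\<^sup>+z. ennreal (c (fst z) (snd z)) \<partial>\<pi>) + ereal \<epsilon> * KL \<pi> (\<mu> \<Otimes>\<^sub>M \<nu>)"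
proof -
  interpret pi: prob_space \<pi>
    by (rule prob_space_coupling)
  let ?\<xi> = "\<mu> \<Otimes>\<^sub>M \<nu>"
  define R where "R = RN_deriv ?\<xi> \<pi>"
  define r where "r z = enn2real (R z)" for z
  have cost_nonneg: "0 \<le> (LINT z|\<pi>. slice_cost z)"
    by (simp add: slice_cost_nonneg)
  show ?thesis
  proof (cases "absolutely_continuous ?\<xi> \<pi> \<and> integrable \<pi> (\<lambda>z. ln (r z) - 1)")
    case False
    then have "KL \<pi> ?\<xi> = \<infinity>"
      unfolding r_def R_def KL_def by (simp only: if_False)
    then show ?thesis
      using eps by (simp add: nn_integral_cost_coupling cost_nonneg)
  next
    case True
    then have ac: "absolutely_continuous ?\<xi> \<pi>" and int: "integrable \<pi> (\<lambda>z. ln (r z) - 1)"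
      by auto
    have dens: "density ?\<xi> R = \<pi>"
      unfolding R_def using ac sets_coupling by (rule munu.density_RN_deriv)
    have Rm [measurable]: "R \<in> borel_measurable ?\<xi>"
      by (simp add: R_def)
    have rm [measurable]: "r \<in> borel_measurable ?\<xi>"
      unfolding r_def[abs_def] by measurable
    have "AE z in ?\<xi>. R z \<noteq> \<infinity>"
      unfolding R_def using pi.sigma_finite_measure_axioms ac sets_coupling
      by (rule munu.RN_deriv_finite)
    then have "AE z in density ?\<xi> R. 0 < r z"
      unfolding AE_density[OF Rm]
      by (rule eventually_mono) (simp add: r_def enn2real_positive_iff top.not_eq_extremum)
    then have r_pos: "AE z in \<pi>. 0 < r z"
      unfolding dens .
    have "(\<integral>\<^sup>+z. ennreal (exp (logdens v z) / r z) \<partial>\<pi>)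
        = (\<integral>\<^sup>+z. ennreal (exp (logdens v z) / r z) \<partial>(density ?\<xi> R))"
      unfolding dens ..
    also have "\<dots> = (\<integral>\<^sup>+z. R z * ennreal (exp (logdens v z) / r z) \<partial>?\<xi>)"
      by (rule nn_integral_density) measurable
    also have "\<dots> \<le> (\<integral>\<^sup>+z. ennreal (exp (logdens v z)) * 1 \<partial>?\<xi>)"
    proof (rule nn_integral_mono)
      fix z
      show "R z * ennreal (exp (logdens v z) / r z) \<le> ennreal (exp (logdens v z)) * 1"
      proof (cases "R z")
        case (real t)
        then show ?thesis
          by (cases "t = 0") (auto simp: r_def simp flip: ennreal_mult)
      qed (simp add: r_def)
    qed
    also have "\<dots> = 1"
      by (subst nn_integral_exp_logdens)
        (auto simp: less_imp_le[OF plan_pos] plan_sum mu.emeasure_space_1 sum_ennreal)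
    finally have nn: "(\<integral>\<^sup>+z. ennreal (exp (logdens v z) / r z) \<partial>\<pi>) \<le> 1" .
    have int_q: "integrable \<pi> (\<lambda>z. exp (logdens v z) / r z)"
      by (rule integrableI_nonneg) (use nn in \<open>auto simp: r_def less_top[symmetric] top_unique\<close>)
    have "(LINT z|\<pi>. exp (logdens v z) / r z) \<le> 1"
      using nn by (subst (asm) nn_integral_eq_integral[OF int_q]) (auto simp: r_def)
    moreover have "(LINT z|\<pi>. logdens v z) - (LINT z|\<pi>. ln (r z) - 1) \<le> (LINT z|\<pi>. exp (logdens v z) / r z)"
      unfolding Bochner_Integration.integral_diff[OF logdens_coupling(1)[of v] int, symmetric]
    proof (rule integral_mono_AE)
      show "AE z in \<pi>. logdens v z - (ln (r z) - 1) \<le> exp (logdens v z) / r z"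
        using r_pos
      proof eventually_elim
        case (elim z)
        have "ln (exp (logdens v z) / r z) \<le> exp (logdens v z) / r z - 1"
          using elim by (intro ln_le_minus_one) auto
        then show ?case
          using elim by (simp add: ln_div)
      qed
    qed (intro Bochner_Integration.integrable_diff logdens_coupling(1) int int_q)+
    ultimately have "\<epsilon> * ((LINT z|\<pi>. logdens v z) - 1) \<le> \<epsilon> * (LINT z|\<pi>. ln (r z) - 1)"
      using eps by (intro mult_left_mono) auto
    then have "- H v \<le> (LINT z|\<pi>. slice_cost z) + \<epsilon> * (LINT z|\<pi>. ln (r z) - 1)"
      by (simp add: logdens_coupling(2))
    moreover have "KL \<pi> ?\<xi> = ereal (LINT z|\<pi>. ln (r z) - 1)"
      using True unfolding r_def R_def KL_def by simp
    ultimately show ?thesis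
      by (simp add: nn_integral_cost_coupling cost_nonneg)
  qed
qed

end

text \<open>The first marginal is correct for every \<open>v\<close> because \<open>plan x v\<close> sums to one.  The mass of the
  second marginal at \<open>y j\<close> is the mean of \<open>plan x v $ j\<close>, which equals \<open>w $ j\<close> exactly when the
  corresponding coordinate of the gradient vanishes.\<close>

lemma gibbs_coupling:
  assumes "gradH v = 0"
  shows "density (\<mu> \<Otimes>\<^sub>M \<nu>) (\<lambda>z. ennreal (exp (logdens v z))) \<in> couplings \<mu> \<nu>" (is "?\<pi> \<in> _")
proof -
  have "distr ?\<pi> \<mu> fst = \<mu>"
  proof (rule measure_eqI)
    fix A assume "A \<in> sets (distr ?\<pi> \<mu> fst)"
    then have A [measurable]: "A \<in> sets \<mu>" by simp
    have "emeasure (distr ?\<pi> \<mu> fst) A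
        = (\<integral>\<^sup>+z. ennreal (exp (logdens v z)) * indicator (fst -` A \<inter> space (\<mu> \<Otimes>\<^sub>M \<nu>)) z \<partial>(\<mu> \<Otimes>\<^sub>M \<nu>))"
      by (subst emeasure_distr) (auto simp: emeasure_density)
    also have "\<dots> = (\<integral>\<^sup>+z. ennreal (exp (logdens v z)) * indicator A (fst z) \<partial>(\<mu> \<Otimes>\<^sub>M \<nu>))"
      by (intro nn_integral_cong) (auto simp: indicator_def)
    also have "\<dots> = (\<integral>\<^sup>+x. (\<Sum>j\<in>UNIV. ennreal (plan x v $ j) * indicator A x) \<partial>\<mu>)"
      by (subst nn_integral_exp_logdens) auto
    also have "\<dots> = (\<integral>\<^sup>+x. indicator A x \<partial>\<mu>)"
      by (simp add: less_imp_le[OF plan_pos] plan_sum sum_ennreal flip: sum_distrib_right)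
    finally show "emeasure (distr ?\<pi> \<mu> fst) A = emeasure \<mu> A"
      by simp
  qed simp
  moreover have "distr ?\<pi> \<nu> snd = \<nu>"
  proof (rule measure_eqI)
    fix A assume "A \<in> sets (distr ?\<pi> \<nu> snd)"
    then have A [measurable]: "A \<in> sets \<nu>" "A \<in> sets borel" by (simp_all add: sets_nu)
    have plan_int: "integrable \<mu> (\<lambda>x. plan x v $ j)" and plan_w: "(LINT x|\<mu>. plan x v $ j) = w $ j" for j
    proof -
      have g: "grad x v \<bullet> axis j 1 = plan x v $ j - w $ j" for x
        by (simp add: inner_axis grad_h_def)
      have "integrable \<mu> (\<lambda>x. grad x v \<bullet> axis j 1)"
        by (intro integrable_inner_left integrable_grad)
      then have "integrable \<mu> (\<lambda>x. (plan x v $ j - w $ j) + w $ j)"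
        unfolding g by (intro Bochner_Integration.integrable_add) auto
      then show i: "integrable \<mu> (\<lambda>x. plan x v $ j)" by simp
      have "(LINT x|\<mu>. grad x v \<bullet> axis j 1) = 0"
        using gradH_inner[of v "axis j 1"] assms by simp
      then show "(LINT x|\<mu>. plan x v $ j) = w $ j"
        unfolding g by (simp add: i mu.prob_space)
    qed
    have "emeasure (distr ?\<pi> \<nu> snd) A
        = (\<integral>\<^sup>+z. ennreal (exp (logdens v z)) * indicator (snd -` A \<inter> space (\<mu> \<Otimes>\<^sub>M \<nu>)) z \<partial>(\<mu> \<Otimes>\<^sub>M \<nu>))"
      by (subst emeasure_distr) (auto simp: emeasure_density)
    also have "\<dots> = (\<integral>\<^sup>+z. ennreal (exp (logdens v z)) * indicator A (snd z) \<partial>(\<mu> \<Otimes>\<^sub>M \<nu>))"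
      by (intro nn_integral_cong) (auto simp: indicator_def)
    also have "\<dots> = (\<integral>\<^sup>+x. (\<Sum>j\<in>UNIV. ennreal (plan x v $ j) * indicator A (y j)) \<partial>\<mu>)"
      by (subst nn_integral_exp_logdens) auto
    also have "\<dots> = (\<Sum>j\<in>UNIV. (\<integral>\<^sup>+x. ennreal (plan x v $ j) \<partial>\<mu>) * indicator A (y j))"
    proof -
      have [measurable]: "(\<lambda>x. plan x v $ j) \<in> borel_measurable \<mu>" for j
        using plan_int by auto
      show ?thesis
        by (subst nn_integral_sum) (simp_all add: nn_integral_multc)
    qed
    also have "\<dots> = (\<Sum>j\<in>UNIV. ennreal (w $ j) * indicator A (y j))"
      by (simp add: nn_integral_eq_integral[OF plan_int] plan_w less_imp_le[OF plan_pos])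
    finally show "emeasure (distr ?\<pi> \<nu> snd) A = emeasure \<nu> A"
      by (simp add: emeasure_discrete_measure[OF A(2)])
  qed simp
  ultimately show ?thesis
    by (simp add: couplings_def)
qed

theorem W_reg_eq:
  assumes min: "\<And>v. H u \<le> H v"
  shows "W_reg \<epsilon> c \<mu> \<nu> = ereal (- H u)"
proof (rule antisym)
  let ?\<xi> = "\<mu> \<Otimes>\<^sub>M \<nu>"
  define \<pi> where "\<pi> = density ?\<xi> (\<lambda>z. ennreal (exp (logdens u z)))"
  have cpl: "\<pi> \<in> couplings \<mu> \<nu>"
    unfolding \<pi>_def by (intro gibbs_coupling gradH_eq_0 min)
  have m: "(\<lambda>z. ennreal (exp (logdens u z))) \<in> borel_measurable ?\<xi>"
    by measurable
  have ac: "absolutely_continuous ?\<xi> \<pi>"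
    unfolding \<pi>_def by (rule absolutely_continuousI_density[OF m])
  have "AE z in ?\<xi>. ennreal (exp (logdens u z)) = RN_deriv ?\<xi> \<pi> z"
    using m \<pi>_def[symmetric] by (rule munu.RN_deriv_unique)
  then have ae: "AE z in \<pi>. ln (enn2real (RN_deriv ?\<xi> \<pi> z)) - 1 = logdens u z - 1"
    unfolding \<pi>_def AE_density[OF m]
    by (rule eventually_mono) (metis enn2real_ennreal exp_ge_zero ln_exp)
  interpret pi: prob_space \<pi>
    by (rule prob_space_coupling[OF cpl])
  have [measurable_cong]: "sets \<pi> = sets ?\<xi>"
    by (simp add: \<pi>_def)
  have [measurable]: "RN_deriv ?\<xi> \<pi> \<in> borel_measurable ?\<xi>"
    by simp
  have int: "integrable \<pi> (\<lambda>z. logdens u z - 1)"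
    using logdens_coupling(1)[OF cpl] by simp
  have meas: "(\<lambda>z. ln (enn2real (RN_deriv ?\<xi> \<pi> z)) - 1) \<in> borel_measurable \<pi>"
    "(\<lambda>z. logdens u z - 1) \<in> borel_measurable \<pi>"
    unfolding \<open>sets \<pi> = sets ?\<xi>\<close>[THEN measurable_cong_sets, OF refl] by measurable
  from int have "integrable \<pi> (\<lambda>z. ln (enn2real (RN_deriv ?\<xi> \<pi> z)) - 1)"
    by (subst integrable_cong_AE[OF meas ae])
  moreover have "(LINT z|\<pi>. ln (enn2real (RN_deriv ?\<xi> \<pi> z)) - 1) = (LINT z|\<pi>. logdens u z) - 1"
    using logdens_coupling(1)[OF cpl]
    by (subst integral_cong_AE[OF meas ae]) (simp add: pi.prob_space)
  ultimately have "KL \<pi> ?\<xi> = ereal ((LINT z|\<pi>. logdens u z) - 1)"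
    using ac by (simp add: KL_def)
  then have "enn2ereal (\<integral>\<^sup>+z. ennreal (c (fst z) (snd z)) \<partial>\<pi>) + ereal \<epsilon> * KL \<pi> ?\<xi> = ereal (- H u)"
    using logdens_coupling(2)[OF cpl, of u]
    by (simp add: nn_integral_cost_coupling[OF cpl] slice_cost_nonneg)
  then show "W_reg \<epsilon> c \<mu> \<nu> \<le> ereal (- H u)"
    unfolding W_reg_def using cpl by (metis (no_types, lifting) INF_lower)
  show "ereal (- H u) \<le> W_reg \<epsilon> c \<mu> \<nu>"
    unfolding W_reg_def by (intro INF_greatest weak_duality)
qed

end

section \<open>The Gauss-Newton matrices\<close>

locale sgn_algorithm = semi_dual \<mu> y w c \<epsilon>
  for \<mu> :: "'a::metric_space measure" and y :: "'j::finite \<Rightarrow> 'b::metric_space" and w c \<epsilon> +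
  fixes lab :: "nat \<Rightarrow> 'j" and \<alpha> \<beta> \<gamma> :: real
  assumes lab: "bij_betw lab {1..CARD('j)} UNIV"
    and alpha: "0 \<le> \<alpha>" and beta: "0 < \<beta>" and gamma: "0 < \<gamma>"
    and alpha_beta: "\<alpha> + \<beta> < 1/2"
begin

abbreviation "V \<equiv> sgn_V \<epsilon> c y w lab \<alpha> \<beta> \<gamma>"
abbreviation "S \<equiv> sgn_S \<epsilon> c y w lab \<alpha> \<beta> \<gamma>"
abbreviation "Z \<equiv> Z_vec lab w"

definition damp :: "nat \<Rightarrow> real" where
  "damp n = \<gamma> * (1 + real (n div CARD('j))) powr (- \<beta>)"

lemma damp_nonneg: "0 \<le> damp n"
  using gamma by (simp add: damp_def)

lemma damp_le: "damp n \<le> \<gamma>"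
  using gamma beta powr_mono[of "- \<beta>" 0 "1 + real (n div CARD('j))"]
  by (simp add: damp_def mult_left_le)

lemma damp_antimono: "m \<le> n \<Longrightarrow> damp n \<le> damp m"
  using gamma beta unfolding damp_def
  by (intro mult_left_mono powr_mono2') (auto intro: div_le_mono)

lemma S_Suc_vmult:
  "S v0 x (Suc n) *v u = S v0 x n *v u
     + (grad (x (Suc n)) (V v0 x n) \<bullet> u) *\<^sub>R grad (x (Suc n)) (V v0 x n)
     + (damp (Suc n) * (Z (Suc n) \<bullet> u)) *\<^sub>R Z (Suc n)"
  by (simp add: Let_def matrix_vector_mult_add_rdistrib outer_vmult damp_def
      scaleR_matrix_vector_assoc[symmetric])

lemma S_sym: "u \<bullet> (S v0 x n *v v) = (S v0 x n *v u) \<bullet> v"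
proof (induction n)
  case (Suc n)
  then show ?case
    unfolding S_Suc_vmult
    by (simp add: inner_add_left inner_add_right inner_commute del: sgn_S.simps sgn_V.simps)
qed simp

lemma S_form:
  "u \<bullet> (S v0 x n *v u) = (norm u)\<^sup>2 + (\<Sum>k=1..n. (grad (x k) (V v0 x (k - 1)) \<bullet> u)\<^sup>2)
     + (\<Sum>k=1..n. damp k * (Z k \<bullet> u)\<^sup>2)"
proof (induction n)
  case 0
  show ?case by (simp add: power2_norm_eq_inner)
next
  case (Suc n)
  then show ?case
    unfolding S_Suc_vmult
    by (simp add: inner_add_right inner_commute[of u] power2_eq_square del: sgn_S.simps sgn_V.simps)
qed

lemma norm_Z_le: "norm (Z k) \<le> 1"
proof -
  have "w $ j \<le> 1" for j
    using member_le_sum[of j UNIV "($) w"] by (simp add: w_sum less_imp_le[OF w_pos])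
  then show ?thesis
    by (simp add: Z_vec_def Let_def less_imp_le[OF w_pos])
qed

lemma S_upper: "u \<bullet> (S v0 x n *v u) \<le> (4 + \<gamma>) * (real n + 1) * (norm u)\<^sup>2"
proof -
  have "(\<Sum>k=1..n. (grad (x k) (V v0 x (k - 1)) \<bullet> u)\<^sup>2) \<le> (\<Sum>k=1..n. 4 * (norm u)\<^sup>2)"
  proof (rule sum_mono)
    fix k
    let ?g = "grad (x k) (V v0 x (k - 1))"
    have "\<bar>?g \<bullet> u\<bar> \<le> 2 * norm u"
      using Cauchy_Schwarz_ineq2[of ?g u] mult_right_mono[OF norm_grad_le[of "x k" "V v0 x (k - 1)"], of "norm u"]
      by simp
    from power_mono[OF this, of 2] show "(?g \<bullet> u)\<^sup>2 \<le> 4 * (norm u)\<^sup>2"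
      by (simp add: power_mult_distrib)
  qed
  moreover have "(\<Sum>k=1..n. damp k * (Z k \<bullet> u)\<^sup>2) \<le> (\<Sum>k=1..n. \<gamma> * (norm u)\<^sup>2)"
  proof (intro sum_mono mult_mono damp_le)
    fix k
    have "\<bar>Z k \<bullet> u\<bar> \<le> norm u"
      using Cauchy_Schwarz_ineq2[of "Z k" u] mult_right_mono[OF norm_Z_le[of k], of "norm u"]
      by simp
    from power_mono[OF this, of 2] show "(Z k \<bullet> u)\<^sup>2 \<le> (norm u)\<^sup>2"
      by simp
  qed (use gamma in auto)
  ultimately have "u \<bullet> (S v0 x n *v u) \<le> (norm u)\<^sup>2 + real n * (4 * (norm u)\<^sup>2) + real n * (\<gamma> * (norm u)\<^sup>2)"
    unfolding S_form by simp
  also have "\<dots> \<le> (4 + \<gamma>) * (real n + 1) * (norm u)\<^sup>2"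
    using gamma by (simp add: algebra_simps)
  finally show ?thesis .
qed

text \<open>Each block of \<open>CARD('j)\<close> consecutive damping vectors visits every coordinate once.\<close>

lemma sum_Z_block:
  assumes m: "\<And>j. m \<le> w $ j"
  shows "real q * (m * (norm u)\<^sup>2) \<le> (\<Sum>k=1..CARD('j) * q. (Z k \<bullet> u)\<^sup>2)"
proof (induction q)
  case (Suc q)
  let ?J = "CARD('j)"
  have "(\<Sum>k=?J * q + 1..?J * q + ?J. (Z k \<bullet> u)\<^sup>2) = (\<Sum>i=1..?J. (Z (i + ?J * q) \<bullet> u)\<^sup>2)"
    using sum.shift_bounds_cl_nat_ivl[of "\<lambda>k. (Z k \<bullet> u)\<^sup>2" 1 "?J * q" ?J] by (simp add: add.commute)
  also have "\<dots> = (\<Sum>i=1..?J. w $ lab i * (u $ lab i)\<^sup>2)"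
  proof (rule sum.cong[OF refl])
    fix i assume i: "i \<in> {1..?J}"
    then have "(i + ?J * q - 1) mod ?J = i - 1"
      by (metis Nat.add_diff_assoc2 One_nat_def Suc_le_lessD Suc_pred atLeastAtMost_iff mod_less mod_mult_self2 Suc_le_mono le_imp_less_Suc less_Suc_eq_le)
    then have "Z (i + ?J * q) = sqrt (w $ lab i) *\<^sub>R axis (lab i) 1"
      using i by (simp add: Z_vec_def Let_def)
    then show "(Z (i + ?J * q) \<bullet> u)\<^sup>2 = w $ lab i * (u $ lab i)\<^sup>2"
      by (simp add: inner_axis' power_mult_distrib less_imp_le[OF w_pos])
  qed
  also have "\<dots> = (\<Sum>j\<in>UNIV. w $ j * (u $ j)\<^sup>2)"
    using sum.reindex_bij_betw[OF lab, of "\<lambda>j. w $ j * (u $ j)\<^sup>2"] .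
  also have "\<dots> \<ge> (\<Sum>j\<in>UNIV. m * (u $ j)\<^sup>2)"
    by (intro sum_mono mult_right_mono m) auto
  also have "(\<Sum>j\<in>UNIV. m * (u $ j)\<^sup>2) = m * (norm u)\<^sup>2"
    unfolding power2_norm_eq_inner inner_vec_def by (simp add: power2_eq_square sum_distrib_left)
  finally have "m * (norm u)\<^sup>2 \<le> (\<Sum>k=?J * q + 1..?J * q + ?J. (Z k \<bullet> u)\<^sup>2)" .
  moreover have "(\<Sum>k=1..?J * Suc q. (Z k \<bullet> u)\<^sup>2)
      = (\<Sum>k=1..?J * q. (Z k \<bullet> u)\<^sup>2) + (\<Sum>k=?J * q + 1..?J * q + ?J. (Z k \<bullet> u)\<^sup>2)"
    using sum.ub_add_nat[of 1 "?J * q" "\<lambda>k. (Z k \<bullet> u)\<^sup>2" ?J] by (simp add: add.commute)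
  ultimately show ?case
    using Suc.IH by (simp add: algebra_simps)
qed simp

text \<open>The minimum with 1 accounts for \<open>S\<^sub>0 = I\<close>, the only uniform lower bound before the first block is
  complete; the cardinality converts the number of blocks into the number of steps.\<close>

definition kap :: real where
  "kap = min 1 (\<gamma> * Min (range (($) w))) / real CARD('j)"

lemma kap_pos: "0 < kap"
  using gamma w_pos by (simp add: kap_def)

text \<open>By monotonicity each of the \<open>n\<close> damping coefficients is at least \<open>damp n\<close>, of order \<open>n\<close> to the
  power \<open>- \<beta>\<close>, and the number of complete blocks is of order \<open>n\<close>.\<close>

lemma S_lower: "kap * (real n + 1) powr (1 - \<beta>) * (norm u)\<^sup>2 \<le> u \<bullet> (S v0 x n *v u)"
proof -
  let ?J = "CARD('j)"
  define m where "m = Min (range (($) w))"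
  have m: "m \<le> w $ j" for j
    by (simp add: m_def)
  have m0: "0 < m"
    by (simp add: m_def w_pos)
  define q where "q = n div ?J"
  define a where "a = min 1 (\<gamma> * m)"
  have a: "0 < a" "a \<le> 1" "a \<le> \<gamma> * m"
    using m0 gamma by (auto simp: a_def)
  have b: "(1 + real q) powr (- \<beta>) \<le> 1"
    using powr_mono[of "- \<beta>" 0 "1 + real q"] beta by simp
  have "real n + 1 \<le> real ?J * (1 + real q)"
  proof -
    have "n < ?J * (q + 1)"
      unfolding q_def by (metis dividend_less_times_div mult.commute zero_less_card_finite add.commute mult_Suc Suc_eq_plus1)
    then have "real (n + 1) \<le> real (?J * (q + 1))"
      by (subst of_nat_le_iff) linarith
    then show ?thesis by (simp add: algebra_simps)
  qed
  then have "(real n + 1) powr (1 - \<beta>) \<le> (real ?J * (1 + real q)) powr (1 - \<beta>)"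
    using alpha alpha_beta by (intro powr_mono2) auto
  also have "\<dots> = real ?J powr (1 - \<beta>) * (1 + real q) powr (1 - \<beta>)"
    by (simp add: powr_mult)
  also have "\<dots> \<le> real ?J * (1 + real q) powr (1 - \<beta>)"
    using powr_mono[of "1 - \<beta>" 1 "real ?J"] beta by (intro mult_right_mono) auto
  finally have "kap * (real n + 1) powr (1 - \<beta>) \<le> a * (1 + real q) powr (1 - \<beta>)"
    using a(1) mult_left_mono[of _ _ "a / real ?J"] by (fastforce simp: kap_def a_def[symmetric] m_def[symmetric])
  also have "\<dots> = a * (1 + real q) powr (- \<beta>) + a * real q * (1 + real q) powr (- \<beta>)"
    using powr_add[of "1 + real q" "- \<beta>" 1] by (simp add: algebra_simps)
  also have "\<dots> \<le> 1 + (\<gamma> * m) * real q * (1 + real q) powr (- \<beta>)"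
    using a b by (intro add_mono mult_right_mono mult_le_one) auto
  also have "\<dots> = 1 + damp n * (real q * m)"
    by (simp add: damp_def q_def)
  finally have "kap * (real n + 1) powr (1 - \<beta>) * (norm u)\<^sup>2 \<le> (1 + damp n * (real q * m)) * (norm u)\<^sup>2"
    by (rule mult_right_mono) auto
  also have "\<dots> = (norm u)\<^sup>2 + damp n * (real q * (m * (norm u)\<^sup>2))"
    by (simp add: algebra_simps)
  also have "\<dots> \<le> (norm u)\<^sup>2 + damp n * (\<Sum>k=1..?J * q. (Z k \<bullet> u)\<^sup>2)"
    by (intro add_left_mono mult_left_mono sum_Z_block m damp_nonneg)
  also have "(\<Sum>k=1..?J * q. (Z k \<bullet> u)\<^sup>2) \<le> (\<Sum>k=1..n. (Z k \<bullet> u)\<^sup>2)"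
    by (intro sum_mono2) (auto simp: q_def intro: order_trans)
  then have "damp n * (\<Sum>k=1..?J * q. (Z k \<bullet> u)\<^sup>2) \<le> (\<Sum>k=1..n. damp n * (Z k \<bullet> u)\<^sup>2)"
    unfolding sum_distrib_left[symmetric] by (intro mult_left_mono damp_nonneg)
  also have "(\<Sum>k=1..n. damp n * (Z k \<bullet> u)\<^sup>2) \<le> (\<Sum>k=1..n. damp k * (Z k \<bullet> u)\<^sup>2)"
    by (intro sum_mono mult_right_mono damp_antimono) auto
  finally have "kap * (real n + 1) powr (1 - \<beta>) * (norm u)\<^sup>2
      \<le> (norm u)\<^sup>2 + (\<Sum>k=1..n. damp k * (Z k \<bullet> u)\<^sup>2)"
    by simp
  also have "\<dots> \<le> u \<bullet> (S v0 x n *v u)"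
    unfolding S_form by (simp add: sum_nonneg)
  finally show ?thesis .
qed

lemma coercive_S: "coercive_matrix (S v0 x n) (kap * (real n + 1) powr (1 - \<beta>))"
  using kap_pos by unfold_locales (rule S_sym, rule S_lower, simp)

section \<open>The steps of the algorithm\<close>

definition lam :: "nat \<Rightarrow> real" where
  "lam n = kap * (real n + 1) powr (1 - \<beta>)"

text \<open>Up to a constant, an upper bound for the gain times the norm of the inverse of the matrix.\<close>

definition rate :: "nat \<Rightarrow> real" where
  "rate n = (real n + 1) powr (\<alpha> + \<beta> - 1)"

lemma lam_pos: "0 < lam n"
  using kap_pos by (simp add: lam_def)

lemma gain_nonneg: "0 \<le> gain \<alpha> n"
  by (simp add: gain_def)

lemma gain_ge_1: "1 \<le> n \<Longrightarrow> 1 \<le> gain \<alpha> n"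
  using alpha by (simp add: gain_def ge_one_powr_ge_zero)

lemma gain_lam_le: "gain \<alpha> n / lam n \<le> rate n / kap"
proof -
  have "gain \<alpha> n \<le> (real n + 1) powr \<alpha>"
    using alpha by (simp add: gain_def powr_mono2)
  then have "gain \<alpha> n / (real n + 1) powr (1 - \<beta>) \<le> (real n + 1) powr \<alpha> / (real n + 1) powr (1 - \<beta>)"
    by (intro divide_right_mono) auto
  also have "\<dots> = rate n"
    unfolding rate_def by (simp add: powr_diff[symmetric] algebra_simps)
  finally have "gain \<alpha> n / (real n + 1) powr (1 - \<beta>) / kap \<le> rate n / kap"
    using kap_pos by (intro divide_right_mono) auto
  then show ?thesis
    by (simp add: lam_def field_simps)
qed

text \<open>This is where \<open>\<alpha> + \<beta> < 1/2\<close> enters.\<close>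

lemma summable_rate_sq: "summable (\<lambda>n. (rate n)\<^sup>2)"
proof -
  have "summable (\<lambda>n. real (Suc n) powr (2 * (\<alpha> + \<beta>) - 2))"
    unfolding summable_Suc_iff[of "\<lambda>n. real n powr (2 * (\<alpha> + \<beta>) - 2)"] summable_real_powr_iff
    using mult_strict_left_mono[OF alpha_beta, of 2] by simp
  moreover have "(rate n)\<^sup>2 = real (Suc n) powr (2 * (\<alpha> + \<beta>) - 2)" for n
    unfolding rate_def power2_eq_square by (simp add: algebra_simps flip: powr_add)
  ultimately show ?thesis by simp
qed

definition Sinv :: "real ^ 'j \<Rightarrow> (nat \<Rightarrow> 'a) \<Rightarrow> nat \<Rightarrow> real ^ 'j \<Rightarrow> real ^ 'j" where
  "Sinv v0 x n g = matrix_inv (S v0 x n) *v g"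

lemma norm_Sinv_le: "norm (Sinv v0 x n g) \<le> norm g / lam n"
  using coercive_matrix.norm_inv_le[OF coercive_S] by (simp add: Sinv_def lam_def)

lemma gain_Sinv_le:
  assumes "norm g \<le> 2"
  shows "gain \<alpha> n * norm (Sinv v0 x n g) \<le> 2 / kap * rate n"
proof -
  have "gain \<alpha> n * norm (Sinv v0 x n g) \<le> gain \<alpha> n * (2 / lam n)"
    using norm_Sinv_le[of v0 x n g] divide_right_mono[OF assms, of "lam n"] lam_pos[of n]
    by (intro mult_left_mono gain_nonneg) auto
  also have "\<dots> = 2 * (gain \<alpha> n / lam n)"
    by simp
  also have "\<dots> \<le> 2 * (rate n / kap)"
    by (intro mult_left_mono gain_lam_le) simp
  finally show ?thesis by simp
qed

lemma V_in_v_perp: "v0 \<in> v_perp \<Longrightarrow> V v0 x n \<in> v_perp"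
  by (cases n) (auto simp: Let_def P_mat_in_v_perp)

lemma V_Suc:
  assumes "v0 \<in> v_perp"
  shows "V v0 x (Suc n) = V v0 x n
    + (- gain \<alpha> n) *\<^sub>R (P_mat *v Sinv v0 x n (grad (x (Suc n)) (V v0 x n)))"
  using P_mat_id[OF V_in_v_perp[OF assms, of x n]]
  by (simp add: Let_def Sinv_def matrix_vector_mult_diff_distrib matrix_vector_mult_scaleR)

definition drift_const :: real where
  "drift_const = 2 / (kap * (\<alpha> + \<beta>))"

lemma norm_V_le:
  assumes "v0 \<in> v_perp"
  shows "norm (V v0 x n) \<le> norm v0 + drift_const * real n powr (\<alpha> + \<beta>)"
proof (induction n)
  case 0
  show ?case by simp
next
  case (Suc n)
  let ?\<rho> = "\<alpha> + \<beta>" and ?s = "Sinv v0 x n (grad (x (Suc n)) (V v0 x n))"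
  have \<rho>: "0 < ?\<rho>" "?\<rho> < 1"
    using alpha beta alpha_beta by auto
  have "norm (V v0 x (Suc n)) \<le> norm (V v0 x n) + gain \<alpha> n * norm (P_mat *v ?s)"
    unfolding V_Suc[OF assms] by (rule order_trans[OF norm_triangle_ineq]) (simp add: gain_nonneg)
  also have "gain \<alpha> n * norm (P_mat *v ?s) \<le> gain \<alpha> n * norm ?s"
    by (intro mult_left_mono norm_P_mat_le gain_nonneg)
  also have "\<dots> \<le> 2 / kap * rate n"
    by (intro gain_Sinv_le norm_grad_le)
  also have "\<dots> = drift_const * (?\<rho> * (real n + 1) powr (?\<rho> - 1))"
    using \<rho> by (simp add: drift_const_def rate_def)
  also have "\<dots> \<le> drift_const * ((real n + 1) powr ?\<rho> - real n powr ?\<rho>)"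
    using \<rho> kap_pos by (intro mult_left_mono powr_diff_ge) (auto simp: drift_const_def)
  finally show ?case
    using Suc.IH by (simp add: algebra_simps)
qed

text \<open>The fluctuation of the first order decrease of \<open>H\<close>; symmetry of the inverse moves it onto the
  gradient of \<open>H\<close>, so that the first factor is determined by the past.\<close>

definition noise :: "real ^ 'j \<Rightarrow> (nat \<Rightarrow> 'a) \<Rightarrow> nat \<Rightarrow> real" where
  "noise v0 x n = gain \<alpha> n * (Sinv v0 x n (gradH (V v0 x n))
      \<bullet> (grad (x (Suc n)) (V v0 x n) - gradH (V v0 x n)))"

lemma abs_noise_le: "\<bar>noise v0 x n\<bar> \<le> 8 / kap * rate n"
proof -
  let ?v = "V v0 x n"
  have "\<bar>noise v0 x n\<bar> \<le> gain \<alpha> n * (norm (Sinv v0 x n (gradH ?v)) * norm (grad (x (Suc n)) ?v - gradH ?v))"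
    unfolding noise_def abs_mult using gain_nonneg by (simp add: mult_left_mono Cauchy_Schwarz_ineq2)
  also have "\<dots> = (gain \<alpha> n * norm (Sinv v0 x n (gradH ?v))) * norm (grad (x (Suc n)) ?v - gradH ?v)"
    by simp
  also have "\<dots> \<le> (2 / kap * rate n) * 4"
  proof (rule mult_mono)
    show "gain \<alpha> n * norm (Sinv v0 x n (gradH ?v)) \<le> 2 / kap * rate n"
      by (intro gain_Sinv_le norm_gradH_le)
    show "norm (grad (x (Suc n)) ?v - gradH ?v) \<le> 4"
      using norm_triangle_ineq4[of "grad (x (Suc n)) ?v" "gradH ?v"] norm_grad_le[of "x (Suc n)" ?v]
        norm_gradH_le[of ?v] by linarith
  qed (use kap_pos in \<open>auto simp: rate_def\<close>)
  finally show ?thesis by simp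
qed

text \<open>Insert the step into the quadratic upper bound for \<open>H\<close>.  The projection disappears from the linear
  term because the gradient of \<open>H\<close> is already orthogonal to \<open>v_unit\<close>.\<close>

lemma descent:
  assumes "v0 \<in> v_perp"
  shows "H (V v0 x (Suc n)) + gain \<alpha> n * ((norm (gradH (V v0 x n)))\<^sup>2 / ((4 + \<gamma>) * (real n + 1)))
      + noise v0 x n \<le> H (V v0 x n) + 2 / \<epsilon> * (2 / kap)\<^sup>2 * (rate n)\<^sup>2"
proof -
  let ?v = "V v0 x n"
  let ?g = "grad (x (Suc n)) ?v" and ?G = "gradH ?v"
  let ?s = "Sinv v0 x n ?g"
  have "norm (gain \<alpha> n *\<^sub>R (P_mat *v ?s)) \<le> gain \<alpha> n * norm ?s"
    using gain_nonneg[of n] norm_P_mat_le[of ?s] by (simp add: mult_left_mono)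
  also have "\<dots> \<le> 2 / kap * rate n"
    by (intro gain_Sinv_le norm_grad_le)
  finally have "(norm (gain \<alpha> n *\<^sub>R (P_mat *v ?s)))\<^sup>2 \<le> (2 / kap * rate n)\<^sup>2"
    by (intro power_mono) auto
  moreover have "norm ((- gain \<alpha> n) *\<^sub>R (P_mat *v ?s)) = norm (gain \<alpha> n *\<^sub>R (P_mat *v ?s))"
    by simp
  ultimately have quad: "2 / \<epsilon> * (norm ((- gain \<alpha> n) *\<^sub>R (P_mat *v ?s)))\<^sup>2
      \<le> 2 / \<epsilon> * ((2 / kap)\<^sup>2 * (rate n)\<^sup>2)"
    unfolding power_mult_distrib[of "2 / kap" "rate n"] using eps
    by (metis mult_left_mono divide_nonneg_pos zero_le_numeral)
  have "?G \<bullet> (P_mat *v ?s) = ?G \<bullet> ?s"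
    by (simp add: P_mat_vmult inner_diff_right gradH_perp)
  also have "\<dots> = Sinv v0 x n ?G \<bullet> ?g"
    unfolding Sinv_def by (rule coercive_matrix.inv_sym[OF coercive_S])
  also have "\<dots> = Sinv v0 x n ?G \<bullet> ?G + Sinv v0 x n ?G \<bullet> (?g - ?G)"
    by (simp add: inner_diff_right)
  finally have lin: "gain \<alpha> n * (?G \<bullet> (P_mat *v ?s)) = gain \<alpha> n * (Sinv v0 x n ?G \<bullet> ?G) + noise v0 x n"
    by (simp add: noise_def distrib_left)
  have "(norm ?G)\<^sup>2 / ((4 + \<gamma>) * (real n + 1)) \<le> ?G \<bullet> Sinv v0 x n ?G"
    unfolding Sinv_def using gamma
    by (intro coercive_matrix.inv_form_ge[OF coercive_S] S_upper) auto
  then have "gain \<alpha> n * ((norm ?G)\<^sup>2 / ((4 + \<gamma>) * (real n + 1))) \<le> gain \<alpha> n * (Sinv v0 x n ?G \<bullet> ?G)"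
    by (intro mult_left_mono gain_nonneg) (simp add: inner_commute)
  moreover have "H (V v0 x (Suc n)) \<le> H ?v + ?G \<bullet> ((- gain \<alpha> n) *\<^sub>R (P_mat *v ?s))
      + 2 / \<epsilon> * (norm ((- gain \<alpha> n) *\<^sub>R (P_mat *v ?s)))\<^sup>2"
    unfolding V_Suc[OF assms] by (rule H_smooth)
  moreover have "?G \<bullet> ((- gain \<alpha> n) *\<^sub>R (P_mat *v ?s)) = - (gain \<alpha> n * (?G \<bullet> (P_mat *v ?s)))"
    by simp
  ultimately show ?thesis
    using quad lin by (simp add: mult.assoc)
qed

text \<open>The deterministic half of the convergence proof: on every path where the noise has a convergent
  series, \<open>H\<close> tends to its minimum along the iterates.\<close>

lemma H_V_tendsto:
  assumes v0: "v0 \<in> v_perp" and min: "\<And>v. H u \<le> H v" and noise: "summable (noise v0 x)"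
  shows "(\<lambda>n. H (V v0 x n)) \<longlonglongrightarrow> H u"
proof -
  define b where "b n = gain \<alpha> n * ((norm (gradH (V v0 x n)))\<^sup>2 / ((4 + \<gamma>) * (real n + 1)))" for n
  have b0: "0 \<le> b n" for n
    unfolding b_def using gamma by (intro mult_nonneg_nonneg gain_nonneg divide_nonneg_nonneg) auto
  have rs: "summable (\<lambda>n. 2 / \<epsilon> * (2 / kap)\<^sup>2 * (rate n)\<^sup>2)"
    by (intro summable_mult summable_rate_sq)
  have step: "H (V v0 x (Suc n)) + b n + noise v0 x n
      \<le> H (V v0 x n) + 2 / \<epsilon> * (2 / kap)\<^sup>2 * (rate n)\<^sup>2" for n
    unfolding b_def by (rule descent[OF v0])
  note RS = robbins_siegmund_deterministic[of "\<lambda>n. H (V v0 x n)" b "noise v0 x", OF step b0 min noise rs]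
  have conv: "convergent (\<lambda>n. H (V v0 x n))" and bsum: "summable b"
    by (rule RS)+
  obtain l where l: "(\<lambda>n. H (V v0 x n)) \<longlonglongrightarrow> l"
    using conv by (auto simp: convergent_def)
  obtain C where C: "\<And>n. \<bar>H (V v0 x n)\<bar> \<le> C"
    using convergent_imp_Bseq[OF conv] unfolding Bseq_def by auto
  obtain p q where p: "0 < p" and pq: "\<And>v. v \<in> v_perp \<Longrightarrow> p * norm v \<le> H v + q"
    by (rule H_coercive) blast
  define R where "R = (\<bar>C\<bar> + \<bar>q\<bar>) / p + norm u + 1"
  have R: "norm (u - V v0 x n) \<le> R" for n
  proof -
    have "p * norm (V v0 x n) \<le> \<bar>C\<bar> + \<bar>q\<bar>"
      using pq[OF V_in_v_perp[OF v0, of x n]] C[of n] by linarith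
    then have "norm (V v0 x n) \<le> (\<bar>C\<bar> + \<bar>q\<bar>) / p"
      using p by (simp add: field_simps)
    then show ?thesis
      using norm_triangle_ineq4[of u "V v0 x n"] by (simp add: R_def)
  qed
  have R0: "0 < R"
  proof -
    have "0 \<le> (\<bar>C\<bar> + \<bar>q\<bar>) / p"
      using p by simp
    then show ?thesis
      unfolding R_def using norm_ge_zero[of u] by linarith
  qed
  define d where "d n = H (V v0 x n) - H u" for n
  have d0: "0 \<le> d n" for n
    using min by (simp add: d_def)
  have d_le: "d n \<le> R * norm (gradH (V v0 x n))" for n
  proof -
    let ?v = "V v0 x n"
    have "H ?v + gradH ?v \<bullet> (u - ?v) \<le> H u"
      using H_convex[of ?v "u - ?v"] by simp
    then have "d n \<le> - (gradH ?v \<bullet> (u - ?v))"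
      by (simp add: d_def)
    also have "\<dots> \<le> norm (gradH ?v) * norm (u - ?v)"
      using Cauchy_Schwarz_ineq2[of "gradH ?v" "u - ?v"] by linarith
    also have "\<dots> \<le> norm (gradH ?v) * R"
      by (intro mult_left_mono R) auto
    finally show ?thesis by (simp add: mult.commute)
  qed
  have "summable (\<lambda>n. (d n)\<^sup>2 / real (Suc n))"
  proof (rule summable_comparison_test)
    show "summable (\<lambda>n. R\<^sup>2 * (4 + \<gamma>) * b n)"
      by (intro summable_mult bsum)
    \<comment> \<open>The index 0 is excluded because \<open>gain \<alpha> 0 = 0\<close> for positive \<open>\<alpha>\<close>.\<close>
    have "norm ((d n)\<^sup>2 / real (Suc n)) \<le> R\<^sup>2 * (4 + \<gamma>) * b n" if "n \<ge> 1" for n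
    proof -
      let ?G = "gradH (V v0 x n)"
      have "(d n)\<^sup>2 \<le> R\<^sup>2 * (norm ?G)\<^sup>2"
        using power_mono[OF d_le d0, of n 2] by (simp add: power_mult_distrib)
      then have "(d n)\<^sup>2 / real (Suc n) \<le> R\<^sup>2 * (norm ?G)\<^sup>2 / real (Suc n)"
        by (rule divide_right_mono) simp
      also have "\<dots> = 1 * (R\<^sup>2 * (4 + \<gamma>) * ((norm ?G)\<^sup>2 / ((4 + \<gamma>) * (real n + 1))))"
      proof -
        have "(4 + \<gamma>) * ((norm ?G)\<^sup>2 / ((4 + \<gamma>) * (real n + 1))) = (norm ?G)\<^sup>2 / (real n + 1)"
          using gamma by simp
        then show ?thesis
          unfolding mult_1 mult.assoc[of "R\<^sup>2"] by (simp only: of_nat_Suc times_divide_eq_right add.commute)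
      qed
      also have "\<dots> \<le> gain \<alpha> n * (R\<^sup>2 * (4 + \<gamma>) * ((norm ?G)\<^sup>2 / ((4 + \<gamma>) * (real n + 1))))"
        using gain_ge_1[OF that] gamma by (intro mult_right_mono) auto
      also have "\<dots> = R\<^sup>2 * (4 + \<gamma>) * b n"
        by (simp add: b_def)
      finally show ?thesis by simp
    qed
    then show "\<exists>N. \<forall>n\<ge>N. norm ((d n)\<^sup>2 / real (Suc n)) \<le> R\<^sup>2 * (4 + \<gamma>) * b n"
      by blast
  qed
  moreover have "d \<longlonglongrightarrow> l - H u"
    unfolding d_def by (intro tendsto_diff l tendsto_const)
  ultimately have "l - H u = 0"
    using limit_eq_0_of_harmonic[of d] d0 by blast
  then show ?thesis
    using l by simp
qed

end

section \<open>The past and the fresh sample\<close>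

lemma Int_stable_vimage_sets: "Int_stable {f -` A \<inter> \<Omega> | A. A \<in> sets N}"
proof (rule Int_stableI)
  fix a b assume "a \<in> {f -` A \<inter> \<Omega> | A. A \<in> sets N}" "b \<in> {f -` A \<inter> \<Omega> | A. A \<in> sets N}"
  then obtain A B where "A \<in> sets N" "B \<in> sets N" "a = f -` A \<inter> \<Omega>" "b = f -` B \<inter> \<Omega>"
    by blast
  then show "a \<inter> b \<in> {f -` A \<inter> \<Omega> | A. A \<in> sets N}"
    by (intro CollectI exI[of _ "A \<inter> B"]) auto
qed

locale sgn_process = sgn_algorithm \<mu> y w c \<epsilon> lab \<alpha> \<beta> \<gamma> + prob_space M
  for \<mu> :: "'a::metric_space measure" and y :: "'j::finite \<Rightarrow> 'b::metric_space" and w c \<epsilon> lab \<alpha> \<beta> \<gamma>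
    and M :: "'w measure" +
  fixes X :: "nat \<Rightarrow> 'w \<Rightarrow> 'a" and V0 :: "'w \<Rightarrow> real ^ 'j"
  assumes X_indep: "indep_vars (\<lambda>_. borel) X {1..}"
    and X_distr: "\<And>n. n \<ge> 1 \<Longrightarrow> distr M borel (X n) = \<mu>"
    and V0_meas: "V0 \<in> borel_measurable M"
    and V0_sq: "integrable M (\<lambda>\<omega>. (norm (V0 \<omega>))\<^sup>2)"
    and V0_perp: "\<And>\<omega>. \<omega> \<in> space M \<Longrightarrow> V0 \<omega> \<in> v_perp"
    and V0_indep: "indep_set
       (sets (vimage_algebra (space M) V0 borel))
       (sets (vimage_algebra (space M) (\<lambda>\<omega>. \<lambda>n\<in>{1..}. X n \<omega>) (\<Pi>\<^sub>M n\<in>{1..}. borel)))"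
begin

text \<open>Index 0 stands for the initial vector, index \<open>i > 0\<close> for the sample \<open>X i\<close>.\<close>

definition gen :: "nat \<Rightarrow> 'w set set" where
  "gen i = (if i = 0 then {V0 -` A \<inter> space M | A. A \<in> sets borel}
     else {X i -` A \<inter> space M | A. A \<in> sets borel})"

definition past :: "nat \<Rightarrow> 'w measure" where
  "past n = sigma (space M) (\<Union>i\<le>n. gen i)"

lemma X_meas: "n \<ge> 1 \<Longrightarrow> X n \<in> measurable M borel"
  using conjunct1[OF X_indep[unfolded indep_vars_def2]] by (rule bspec) simp

lemma gen_events: "gen i \<subseteq> events"
proof
  fix a assume a: "a \<in> gen i"
  show "a \<in> events"
  proof (cases "i = 0")
    case True
    then obtain A where A: "A \<in> sets borel" and eq: "a = V0 -` A \<inter> space M"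
      using a unfolding gen_def if_P[OF True] by blast
    show ?thesis
      unfolding eq by (rule measurable_sets[OF V0_meas A])
  next
    case False
    then obtain A where A: "A \<in> sets borel" and eq: "a = X i -` A \<inter> space M"
      using a unfolding gen_def if_not_P[OF False] by blast
    show ?thesis
      unfolding eq by (rule measurable_sets[OF X_meas A]) (use False in linarith)
  qed
qed

lemma Int_stable_gen: "Int_stable (gen i)"
  by (simp add: gen_def Int_stable_vimage_sets)

text \<open>Independence of the samples and independence of the initial vector from the whole sequence combine
  into one independent family: split off the factor with index 0.\<close>

lemma indep_gen: "indep_sets gen UNIV"
proof (rule indep_setsI)
  show "gen i \<subseteq> events" for i
    by (rule gen_events)
  fix A J assume J: "J \<noteq> {}" "finite J" and A: "\<forall>j\<in>J. A j \<in> gen j"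
  have X_indep': "indep_sets gen {1..}"
    using conjunct2[OF X_indep[unfolded indep_vars_def2]]
    by (rule indep_sets_cong[THEN iffD1, rotated -1]) (simp_all add: gen_def)
  show "prob (\<Inter>j\<in>J. A j) = (\<Prod>j\<in>J. prob (A j))"
  proof (cases "0 \<in> J")
    case False
    then show ?thesis
      using J A by (intro indep_setsD[OF X_indep']) (auto simp: Suc_le_eq intro: gr0I)
  next
    case True
    define K where "K = J - {0}"
    have JK: "J = insert 0 K" "0 \<notin> K" "finite K"
      using True J by (auto simp: K_def)
    show ?thesis
    proof (cases "K = {}")
      case True
      then show ?thesis by (simp add: JK)
    next
      case False
      let ?X = "\<lambda>\<omega>. \<lambda>n\<in>{1..}. X n \<omega>"
      let ?N = "vimage_algebra (space M) ?X (\<Pi>\<^sub>M n\<in>{1..}. borel)"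
      have Xm: "?X \<in> measurable ?N (\<Pi>\<^sub>M n\<in>{1..}. borel)"
        by (rule measurable_vimage_algebra1) (auto simp: space_PiM)
      have AX: "A j \<in> sets ?N" if "j \<in> K" for j
      proof -
        have j: "j \<ge> 1"
          using that JK by (cases j) auto
        have "(\<lambda>\<omega>. ?X \<omega> j) \<in> measurable ?N borel"
          by (rule measurable_compose[OF Xm measurable_component_singleton]) (use j in simp)
        moreover have "(\<lambda>\<omega>. ?X \<omega> j) = X j"
          by (rule ext) (use j in simp)
        ultimately have Xj: "X j \<in> measurable ?N borel"
          by metis
        have "A j \<in> gen j"
          using A that JK by blast
        then obtain B where B: "B \<in> sets borel" and eq: "A j = X j -` B \<inter> space M"
          using j unfolding gen_def by (cases j) auto
        show ?thesis
          using measurable_sets[OF Xj B] unfolding eq space_vimage_algebra .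
      qed
      have A0: "A 0 \<in> sets (vimage_algebra (space M) V0 borel)"
        using A JK by (auto simp: gen_def intro: in_vimage_algebra)
      have "prob (\<Inter>j\<in>J. A j) = prob (A 0 \<inter> (\<Inter>j\<in>K. A j))"
        by (simp add: JK)
      also have "\<dots> = prob (A 0) * prob (\<Inter>j\<in>K. A j)"
        using False JK(3) AX by (intro indep_setD[OF V0_indep A0] sets.finite_INT) auto
      also have "prob (\<Inter>j\<in>K. A j) = (\<Prod>j\<in>K. prob (A j))"
        using JK A False by (intro indep_setsD[OF X_indep']) (auto simp: Suc_le_eq intro: gr0I)
      finally show ?thesis
        using JK by simp
    qed
  qed
qed

lemma gen_Pow: "(\<Union>i\<le>n. gen i) \<subseteq> Pow (space M)"
  using gen_events sets.space_closed by fastforce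

lemma space_past [simp]: "space (past n) = space M"
  unfolding past_def by (rule space_measure_of[OF gen_Pow])

lemma sets_past: "sets (past n) = sigma_sets (space M) (\<Union>i\<le>n. gen i)"
  unfolding past_def by (rule sets_measure_of[OF gen_Pow])

lemma past_mono: "m \<le> n \<Longrightarrow> sets (past m) \<subseteq> sets (past n)"
  unfolding sets_past by (rule sigma_sets_mono') (auto intro: order_trans)

lemma subalgebra_past: "subalgebra M (past n)"
  unfolding subalgebra_def
proof
  show "sets (past n) \<subseteq> events"
    unfolding sets_past by (intro sets.sigma_sets_subset UN_least gen_events)
qed simp

lemma measurable_past_mono: "m \<le> n \<Longrightarrow> f \<in> measurable (past m) N \<Longrightarrow> f \<in> measurable (past n) N"
  using past_mono[of m n] by (auto simp: measurable_def)

lemma measurable_past_M: "f \<in> measurable (past n) N \<Longrightarrow> f \<in> measurable M N"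
  using measurable_from_subalg[OF subalgebra_past] .

lemma gen_past: "i \<le> n \<Longrightarrow> A \<in> gen i \<Longrightarrow> A \<in> sets (past n)"
  unfolding sets_past by (intro sigma_sets.Basic) blast

lemma V0_past: "V0 \<in> borel_measurable (past n)"
proof (rule measurableI)
  fix A :: "(real ^ 'j) set" assume "A \<in> sets borel"
  then have "V0 -` A \<inter> space M \<in> gen 0"
    unfolding gen_def by simp blast
  then show "V0 -` A \<inter> space (past n) \<in> sets (past n)"
    unfolding space_past by (rule gen_past[OF le0])
qed simp

lemma X_past: "1 \<le> i \<Longrightarrow> i \<le> n \<Longrightarrow> X i \<in> measurable (past n) borel"
proof (rule measurableI)
  fix A :: "'a set" assume i: "1 \<le> i" "i \<le> n" and "A \<in> sets borel"
  then have "X i -` A \<inter> space M \<in> gen i"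
    unfolding gen_def by simp blast
  then show "X i -` A \<inter> space (past n) \<in> sets (past n)"
    unfolding space_past by (rule gen_past[OF i(2)])
qed simp

lemma indep_past:
  assumes "A \<in> sets (past n)" "B \<in> sets borel"
  shows "prob (A \<inter> (X (Suc n) -` B \<inter> space M)) = prob A * prob (X (Suc n) -` B \<inter> space M)"
proof -
  have "indep_sets (\<lambda>b. sigma_sets (space M) (\<Union>i\<in>case_bool {..n} {Suc n} b. gen i)) UNIV"
    by (rule indep_sets_collect_sigma)
      (auto simp: Int_stable_gen disjoint_family_on_def split: bool.splits
        intro: indep_sets_mono_index[OF _ indep_gen])
  also have "(\<lambda>b. sigma_sets (space M) (\<Union>i\<in>case_bool {..n} {Suc n} b. gen i))
      = case_bool (sets (past n)) (sigma_sets (space M) (gen (Suc n)))"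
    by (auto simp: sets_past split: bool.splits)
  finally have "indep_set (sets (past n)) (sigma_sets (space M) (gen (Suc n)))"
    unfolding indep_set_def .
  then show ?thesis
    using assms by (intro indep_setD) (auto simp: gen_def)
qed

text \<open>The joint law of the elementary outcome, seen through \<open>past n\<close>, and the next sample is a product measure;
  Fubini's theorem then integrates out the sample first.  Using the identity as the random element
  that carries the past avoids factorizing past functions through the initial vector and the samples.\<close>

lemma integral_fresh_eq_0:
  fixes \<Phi> :: "'w \<times> 'a \<Rightarrow> real"
  assumes Phi: "\<Phi> \<in> borel_measurable (past n \<Otimes>\<^sub>M borel)"
    and int: "integrable M (\<lambda>\<omega>. \<Phi> (\<omega>, X (Suc n) \<omega>))"
    and 0: "\<And>\<omega>. \<omega> \<in> space M \<Longrightarrow> (LINT x|\<mu>. \<Phi> (\<omega>, x)) = 0"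
  shows "(LINT \<omega>|M. \<Phi> (\<omega>, X (Suc n) \<omega>)) = 0"
proof -
  let ?D = "distr M (past n) (\<lambda>\<omega>. \<omega>)"
  have id: "(\<lambda>\<omega>. \<omega>) \<in> measurable M (past n)"
    by (rule measurable_past_M[of _ n]) simp
  have X: "X (Suc n) \<in> measurable M borel"
    by (rule X_meas) simp
  have pm: "(\<lambda>\<omega>. (\<omega>, X (Suc n) \<omega>)) \<in> measurable M (past n \<Otimes>\<^sub>M borel)"
    using id X by (rule measurable_Pair)
  interpret D: prob_space ?D
    by (rule prob_space_distr[OF id])
  interpret P: pair_prob_space ?D \<mu> ..
  have D: "?D \<Otimes>\<^sub>M \<mu> = distr M (past n \<Otimes>\<^sub>M borel) (\<lambda>\<omega>. (\<omega>, X (Suc n) \<omega>))"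
  proof (rule pair_measure_eqI)
    show "sets (?D \<Otimes>\<^sub>M \<mu>) = sets (distr M (past n \<Otimes>\<^sub>M borel) (\<lambda>\<omega>. (\<omega>, X (Suc n) \<omega>)))"
      by (simp add: sets_mu cong: sets_pair_measure_cong)
    fix A B assume "A \<in> sets ?D" "B \<in> sets \<mu>"
    then have A: "A \<in> sets (past n)" and B: "B \<in> sets borel"
      by (auto simp: sets_mu)
    have "emeasure (distr M (past n \<Otimes>\<^sub>M borel) (\<lambda>\<omega>. (\<omega>, X (Suc n) \<omega>))) (A \<times> B)
        = emeasure M (A \<inter> (X (Suc n) -` B \<inter> space M))"
      using A B sets.sets_into_space[OF A] by (subst emeasure_distr[OF pm])
        (auto intro!: arg_cong[where f = "emeasure M"])
    moreover have "emeasure ?D A = emeasure M A"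
      using sets.sets_into_space[OF A]
      by (subst emeasure_distr[OF id A]) (auto intro!: arg_cong[where f = "emeasure M"])
    moreover have "emeasure \<mu> B = emeasure M (X (Suc n) -` B \<inter> space M)"
      using X_distr[of "Suc n"] emeasure_distr[OF X B] by simp
    ultimately show "emeasure ?D A * emeasure \<mu> B
        = emeasure (distr M (past n \<Otimes>\<^sub>M borel) (\<lambda>\<omega>. (\<omega>, X (Suc n) \<omega>))) (A \<times> B)"
      by (simp add: emeasure_eq_measure indep_past[OF A B] ennreal_mult)
  qed unfold_locales
  have "integrable (?D \<Otimes>\<^sub>M \<mu>) \<Phi>"
    unfolding D using integrable_distr_eq[OF pm Phi] int by simp
  from P.integral_fst'[OF this]
  have "(LINT z|(?D \<Otimes>\<^sub>M \<mu>). \<Phi> z) = (LINT \<omega>|?D. LINT x|\<mu>. \<Phi> (\<omega>, x))"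
    by simp
  also have "\<dots> = (LINT \<omega>|?D. 0)"
    by (rule Bochner_Integration.integral_cong) (auto simp: 0)
  finally show ?thesis
    unfolding D integral_distr[OF pm Phi] by simp
qed

section \<open>Almost sure convergence\<close>

abbreviation "VX n \<omega> \<equiv> V (V0 \<omega>) (\<lambda>n. X n \<omega>) n"
abbreviation "SX n \<omega> \<equiv> S (V0 \<omega>) (\<lambda>n. X n \<omega>) n"

lemma invertible_SX: "invertible (SX n \<omega>)"
  by (rule coercive_matrix.invertible[OF coercive_S])

lemma VX_SX_past:
  "VX n \<in> borel_measurable (past n) \<and> (\<forall>i j. (\<lambda>\<omega>. SX n \<omega> $ i $ j) \<in> borel_measurable (past n))"
proof (induction n)
  case 0
  show ?case
    using V0_past[of 0] by simp
next
  case (Suc n)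
  let ?P = "past (Suc n)"
  let ?g = "\<lambda>\<omega>. grad (X (Suc n) \<omega>) (VX n \<omega>)"
  have V: "VX n \<in> borel_measurable ?P" and S: "(\<lambda>\<omega>. SX n \<omega> $ i $ j) \<in> borel_measurable ?P" for i j
    using Suc.IH measurable_past_mono[of n "Suc n"] by auto
  have g: "?g \<in> borel_measurable ?P"
    by (rule grad_measurable[OF X_past V]) auto
  have gj: "(\<lambda>\<omega>. ?g \<omega> $ j) \<in> borel_measurable ?P" for j
    by (rule nth_measurable[OF g])
  have Vj: "(\<lambda>\<omega>. VX n \<omega> $ j) \<in> borel_measurable ?P" for j
    by (rule nth_measurable[OF V])
  have inv: "(\<lambda>\<omega>. (matrix_inv (SX n \<omega>) *v ?g \<omega>) $ k) \<in> borel_measurable ?P" for k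
    by (intro inv_vmult_measurable S gj invertible_SX)
  have "VX (Suc n) \<in> borel_measurable ?P"
  proof (rule vec_measurableI)
    fix k
    have "VX (Suc n) \<omega> $ k = (\<Sum>j\<in>UNIV. P_mat $ k $ j
        * (VX n \<omega> $ j - gain \<alpha> n * (matrix_inv (SX n \<omega>) *v ?g \<omega>) $ j))" for \<omega>
      by (simp add: Let_def matrix_vector_mult_def[of P_mat])
    then show "(\<lambda>\<omega>. VX (Suc n) \<omega> $ k) \<in> borel_measurable ?P"
      by (simp only:) (intro borel_measurable_sum borel_measurable_times borel_measurable_const
        borel_measurable_diff Vj inv)
  qed
  moreover have "(\<lambda>\<omega>. SX (Suc n) \<omega> $ i $ j) \<in> borel_measurable ?P" for i j
  proof -
    have "SX (Suc n) \<omega> $ i $ j = SX n \<omega> $ i $ j + ?g \<omega> $ i * ?g \<omega> $ j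
        + damp (Suc n) * (Z (Suc n) $ i * Z (Suc n) $ j)" for \<omega>
      by (simp add: Let_def outer_def damp_def)
    then show ?thesis
      by (simp only:) (intro borel_measurable_add borel_measurable_times borel_measurable_const S gj)
  qed
  ultimately show ?case by blast
qed

lemma VX_past: "VX n \<in> borel_measurable (past n)"
  using VX_SX_past by blast

lemma VX_fst: "(\<lambda>z. VX n (fst z)) \<in> borel_measurable (past n \<Otimes>\<^sub>M N)"
  by (rule measurable_compose[OF measurable_fst VX_past])

lemma H_VX_past: "(\<lambda>\<omega>. H (VX n \<omega>)) \<in> borel_measurable (past n)"
  unfolding H_eps_def
proof (rule mu.borel_measurable_lebesgue_integral)
  have "(\<lambda>z. h (snd z) (VX n (fst z))) \<in> borel_measurable (past n \<Otimes>\<^sub>M \<mu>)"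
    by (rule h_measurable[OF measurable_compose[OF measurable_snd id_measurable_mu] VX_fst])
  then show "(\<lambda>(\<omega>, x). h x (VX n \<omega>)) \<in> borel_measurable (past n \<Otimes>\<^sub>M \<mu>)"
    by (simp only: split_beta')
qed

lemma gradH_VX_past: "(\<lambda>\<omega>. gradH (VX n \<omega>)) \<in> borel_measurable (past n)"
  unfolding gradH_def
proof (rule mu.borel_measurable_lebesgue_integral)
  have "(\<lambda>z. grad (snd z) (VX n (fst z))) \<in> borel_measurable (past n \<Otimes>\<^sub>M \<mu>)"
    by (rule grad_measurable[OF measurable_compose[OF measurable_snd id_measurable_mu] VX_fst])
  then show "(\<lambda>(\<omega>, x). grad x (VX n \<omega>)) \<in> borel_measurable (past n \<Otimes>\<^sub>M \<mu>)"
    by (simp only: split_beta')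
qed

lemma past_prod_comp:
  assumes "\<Phi> \<in> borel_measurable (past n \<Otimes>\<^sub>M borel)"
  shows "(\<lambda>\<omega>. \<Phi> (\<omega>, X (Suc n) \<omega>)) \<in> borel_measurable (past (Suc n))"
proof (rule measurable_compose[OF _ assms])
  have "(\<lambda>\<omega>. \<omega>) \<in> measurable (past (Suc n)) (past n)"
    by (rule measurable_past_mono[of n]) auto
  then show "(\<lambda>\<omega>. (\<omega>, X (Suc n) \<omega>)) \<in> measurable (past (Suc n)) (past n \<Otimes>\<^sub>M borel)"
    by (rule measurable_Pair) (rule X_past, auto)
qed

text \<open>A function of the past and of the fresh sample which is centred in the fresh sample is a martingale
  difference.\<close>

lemma L2_martingale_diffI:
  fixes \<Phi> :: "nat \<Rightarrow> 'w \<times> 'a \<Rightarrow> real"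
  assumes Phi: "\<And>n. \<Phi> n \<in> borel_measurable (past n \<Otimes>\<^sub>M borel)"
    and centred: "\<And>n \<omega>. (LINT x|\<mu>. \<Phi> n (\<omega>, x)) = 0"
    and L2: "\<And>n. integrable M (\<lambda>\<omega>. (\<Phi> n (\<omega>, X (Suc n) \<omega>))\<^sup>2)"
  shows "L2_martingale_diff M past (\<lambda>n \<omega>. \<Phi> n (\<omega>, X (Suc n) \<omega>))"
proof
  show "subalgebra M (past n)" for n
    by (rule subalgebra_past)
  show "sets (past m) \<subseteq> sets (past n)" if "m \<le> n" for m n
    by (rule past_mono[OF that])
  show "(\<lambda>\<omega>. \<Phi> n (\<omega>, X (Suc n) \<omega>)) \<in> borel_measurable (past (Suc n))" for n
    by (rule past_prod_comp[OF Phi])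
  show "integrable M (\<lambda>\<omega>. (\<Phi> n (\<omega>, X (Suc n) \<omega>))\<^sup>2)" for n
    by (rule L2)
  fix n Y assume Y: "Y \<in> borel_measurable (past n)"
    and int: "integrable M (\<lambda>\<omega>. Y \<omega> * \<Phi> n (\<omega>, X (Suc n) \<omega>))"
  let ?\<Psi> = "\<lambda>z. Y (fst z) * \<Phi> n z"
  have "?\<Psi> \<in> borel_measurable (past n \<Otimes>\<^sub>M borel)"
    by (intro borel_measurable_times Phi measurable_compose[OF measurable_fst Y])
  from integral_fresh_eq_0[OF this]
  show "(LINT \<omega>|M. Y \<omega> * \<Phi> n (\<omega>, X (Suc n) \<omega>)) = 0"
    using int centred by simp
qed

lemma AE_summable_noise: "AE \<omega> in M. summable (noise (V0 \<omega>) (\<lambda>n. X n \<omega>))"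
proof -
  define u where "u n \<omega> = Sinv (V0 \<omega>) (\<lambda>n. X n \<omega>) n (gradH (VX n \<omega>))" for n \<omega>
  define \<Phi> where "\<Phi> n z = gain \<alpha> n * (u n (fst z) \<bullet> (grad (snd z) (VX n (fst z)) - gradH (VX n (fst z))))" for n z
  have noise_eq: "noise (V0 \<omega>) (\<lambda>n. X n \<omega>) n = \<Phi> n (\<omega>, X (Suc n) \<omega>)" for n \<omega>
    by (simp add: noise_def \<Phi>_def u_def)
  have u: "u n \<in> borel_measurable (past n)" for n
  proof (rule vec_measurableI)
    fix k
    show "(\<lambda>\<omega>. u n \<omega> $ k) \<in> borel_measurable (past n)"
      unfolding u_def Sinv_def
    proof (rule inv_vmult_measurable)
      show "(\<lambda>\<omega>. gradH (VX n \<omega>) $ i) \<in> borel_measurable (past n)" for i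
        by (rule nth_measurable[OF gradH_VX_past])
      show "invertible (SX n \<omega>)" for \<omega>
        by (rule invertible_SX)
      show "(\<lambda>\<omega>. SX n \<omega> $ i $ j) \<in> borel_measurable (past n)" for i j
        using VX_SX_past by blast
    qed
  qed
  have Phi: "\<Phi> n \<in> borel_measurable (past n \<Otimes>\<^sub>M borel)" for n
    unfolding \<Phi>_def
    by (intro borel_measurable_times borel_measurable_const borel_measurable_inner borel_measurable_diff
        measurable_compose[OF measurable_fst u] grad_measurable[OF measurable_snd VX_fst]
        measurable_compose[OF measurable_fst gradH_VX_past])
  have bound: "(\<Phi> n (\<omega>, X (Suc n) \<omega>))\<^sup>2 \<le> (8 / kap)\<^sup>2 * (rate n)\<^sup>2" for n \<omega>
  proof -
    have "\<bar>\<Phi> n (\<omega>, X (Suc n) \<omega>)\<bar> \<le> 8 / kap * rate n"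
      unfolding noise_eq[symmetric] by (rule abs_noise_le)
    from power_mono[OF this abs_ge_zero, of 2] show ?thesis
      unfolding power_mult_distrib power2_abs .
  qed
  have meas: "(\<lambda>\<omega>. (\<Phi> n (\<omega>, X (Suc n) \<omega>))\<^sup>2) \<in> borel_measurable M" for n
    by (rule borel_measurable_power[OF measurable_past_M[OF past_prod_comp[OF Phi]]])
  have int: "integrable M (\<lambda>\<omega>. (\<Phi> n (\<omega>, X (Suc n) \<omega>))\<^sup>2)" for n
    by (rule integrable_const_bound[where B = "(8 / kap)\<^sup>2 * (rate n)\<^sup>2", OF AE_I2 meas]) (use bound in simp)
  interpret L2_martingale_diff M past "\<lambda>n \<omega>. \<Phi> n (\<omega>, X (Suc n) \<omega>)"
  proof (rule L2_martingale_diffI[OF Phi _ int])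
    fix n \<omega>
    let ?v = "VX n \<omega>"
    have "(LINT x|\<mu>. \<Phi> n (\<omega>, x)) = gain \<alpha> n * (LINT x|\<mu>. grad x ?v \<bullet> u n \<omega> - gradH ?v \<bullet> u n \<omega>)"
      unfolding \<Phi>_def by (simp add: inner_commute[of "u n \<omega>"] inner_diff_left)
    also have "(LINT x|\<mu>. grad x ?v \<bullet> u n \<omega> - gradH ?v \<bullet> u n \<omega>) = 0"
      by (subst Bochner_Integration.integral_diff)
        (auto intro!: integrable_inner_left integrable_grad simp: mu.prob_space gradH_inner[symmetric])
    finally show "(LINT x|\<mu>. \<Phi> n (\<omega>, x)) = 0" by simp
  qed
  have "summable (\<lambda>n. LINT \<omega>|M. (\<Phi> n (\<omega>, X (Suc n) \<omega>))\<^sup>2)"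
  proof (rule summable_comparison_test)
    show "summable (\<lambda>n. (8 / kap)\<^sup>2 * (rate n)\<^sup>2)"
      by (intro summable_mult summable_rate_sq)
    have "norm (LINT \<omega>|M. (\<Phi> n (\<omega>, X (Suc n) \<omega>))\<^sup>2) \<le> (8 / kap)\<^sup>2 * (rate n)\<^sup>2" for n
    proof -
      have "(LINT \<omega>|M. (\<Phi> n (\<omega>, X (Suc n) \<omega>))\<^sup>2) \<le> (LINT \<omega>|M. (8 / kap)\<^sup>2 * (rate n)\<^sup>2)"
        by (intro integral_mono int bound) simp
      then show ?thesis
        by (simp add: prob_space)
    qed
    then show "\<exists>N. \<forall>n\<ge>N. norm (LINT \<omega>|M. (\<Phi> n (\<omega>, X (Suc n) \<omega>))\<^sup>2) \<le> (8 / kap)\<^sup>2 * (rate n)\<^sup>2"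
      by blast
  qed
  then show ?thesis
    unfolding noise_eq[abs_def] by (rule AE_summable)
qed

lemma integrable_fresh:
  fixes f :: "'a \<Rightarrow> real"
  assumes "integrable \<mu> f"
  shows "integrable M (\<lambda>\<omega>. f (X (Suc n) \<omega>))" "(LINT \<omega>|M. f (X (Suc n) \<omega>)) = (LINT x|\<mu>. f x)"
proof -
  have X: "X (Suc n) \<in> measurable M borel"
    by (rule X_meas) simp
  have f: "f \<in> borel_measurable borel"
    using borel_measurable_integrable[OF assms] by (simp only: measurable_cong_sets[OF sets_mu refl])
  have d: "distr M borel (X (Suc n)) = \<mu>"
    by (rule X_distr) simp
  show "integrable M (\<lambda>\<omega>. f (X (Suc n) \<omega>))"
    using integrable_distr_eq[OF X f] assms unfolding d by simp
  show "(LINT \<omega>|M. f (X (Suc n) \<omega>)) = (LINT x|\<mu>. f x)"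
    using integral_distr[OF X f] unfolding d by simp
qed

text \<open>Both \<open>h\<close> and \<open>H\<close> grow at most linearly in the dual vector, whose norm is of order
  \<open>n\<^sup>\<alpha>\<^sup>+\<^sup>\<beta>\<close>.  Divided by \<open>n\<close>, the fluctuation is therefore at most \<open>rate n\<close> times a random variable
  with a second moment that does not depend on \<open>n\<close>; this uses the square integrability of the cost
  and of the initial vector.\<close>

lemma AE_mean_fluctuation:
  "AE \<omega> in M. (\<lambda>n. (\<Sum>k<n. h (X (Suc k) \<omega>) (VX k \<omega>) - H (VX k \<omega>)) / real n) \<longlonglongrightarrow> 0"
proof -
  let ?\<rho> = "\<alpha> + \<beta>"
  define \<Phi> where "\<Phi> n z = (h (snd z) (VX n (fst z)) - H (VX n (fst z))) / real (Suc n)" for n z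
  define e where "e n \<omega> = \<Phi> n (\<omega>, X (Suc n) \<omega>)" for n \<omega>
  define EC where "EC = (LINT x|\<mu>. cost_sum x)"
  define A where "A = 2 * Kh + EC + 4 * drift_const"
  define B where "B n \<omega> = 3 * (A\<^sup>2 + 16 * (norm (V0 \<omega>))\<^sup>2 + (cost_sum (X (Suc n) \<omega>))\<^sup>2)" for n \<omega>
  define EB where "EB = 3 * (A\<^sup>2 + 16 * (LINT \<omega>|M. (norm (V0 \<omega>))\<^sup>2) + (LINT x|\<mu>. (cost_sum x)\<^sup>2))"
  have EC0: "0 \<le> EC"
    unfolding EC_def cost_sum_def by (intro integral_nonneg_AE AE_I2 sum_nonneg c_nonneg)
  have Kh0: "0 \<le> Kh"
    unfolding Kh_def using eps by (simp add: sum_nonneg)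
  have \<rho>: "0 < ?\<rho>"
    using alpha beta by simp
  have drift_nonneg: "0 \<le> drift_const"
    unfolding drift_const_def using kap_pos \<rho> by simp
  have A0: "0 \<le> A"
    unfolding A_def using EC0 Kh0 drift_nonneg by simp
  have absH: "\<bar>H v\<bar> \<le> Kh + 2 * norm v + EC" for v
  proof -
    have "\<bar>H v\<bar> \<le> (LINT x|\<mu>. \<bar>h x v\<bar>)"
      unfolding H_eps_def by (rule integral_abs_bound)
    also have "\<dots> \<le> (LINT x|\<mu>. Kh + 2 * norm v + cost_sum x)"
      by (intro integral_mono integrable_abs integrable_h abs_h_le Bochner_Integration.integrable_add
          integrable_cost_sum) auto
    also have "\<dots> = Kh + 2 * norm v + EC"
      unfolding EC_def by (subst Bochner_Integration.integral_add) (auto simp: integrable_cost_sum mu.prob_space)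
    finally show ?thesis .
  qed
  have Phi: "\<Phi> n \<in> borel_measurable (past n \<Otimes>\<^sub>M borel)" for n
    unfolding \<Phi>_def
    by (intro borel_measurable_divide borel_measurable_const borel_measurable_diff
        h_measurable[OF measurable_snd VX_fst] measurable_compose[OF measurable_fst H_VX_past])
  have bound: "(e n \<omega>)\<^sup>2 \<le> (rate n)\<^sup>2 * B n \<omega>" if \<omega>: "\<omega> \<in> space M" for n \<omega>
  proof -
    let ?v = "VX n \<omega>" and ?x = "X (Suc n) \<omega>" and ?r = "(real n + 1) powr ?\<rho>"
    have r1: "1 \<le> ?r"
      using \<rho> by (simp add: ge_one_powr_ge_zero)
    have cs: "0 \<le> cost_sum ?x"
      unfolding cost_sum_def by (simp add: sum_nonneg c_nonneg)
    have nv: "norm ?v \<le> norm (V0 \<omega>) + drift_const * ?r"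
    proof -
      have "norm ?v \<le> norm (V0 \<omega>) + drift_const * real n powr ?\<rho>"
        by (rule norm_V_le[OF V0_perp[OF \<omega>]])
      also have "drift_const * real n powr ?\<rho> \<le> drift_const * ?r"
        using \<rho> drift_nonneg by (intro mult_left_mono powr_mono2) auto
      finally show ?thesis by simp
    qed
    have "\<bar>h ?x ?v - H ?v\<bar> \<le> (2 * Kh + EC) + 4 * norm ?v + cost_sum ?x"
      using abs_h_le[of ?x ?v] absH[of ?v] by linarith
    also have "\<dots> \<le> (2 * Kh + EC) + 4 * (norm (V0 \<omega>) + drift_const * ?r) + cost_sum ?x"
      using nv by simp
    also have "\<dots> = (2 * Kh + EC + 4 * norm (V0 \<omega>) + cost_sum ?x) * 1 + 4 * drift_const * ?r"
      by simp
    also have "\<dots> \<le> (2 * Kh + EC + 4 * norm (V0 \<omega>) + cost_sum ?x) * ?r + 4 * drift_const * ?r"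
      using r1 Kh0 EC0 cs by (intro add_right_mono mult_left_mono) auto
    also have "\<dots> = ?r * (A + 4 * norm (V0 \<omega>) + cost_sum ?x)"
      by (simp add: A_def algebra_simps)
    finally have "\<bar>h ?x ?v - H ?v\<bar> / real (Suc n) \<le> ?r * (A + 4 * norm (V0 \<omega>) + cost_sum ?x) / real (Suc n)"
      by (rule divide_right_mono) simp
    moreover have "\<bar>e n \<omega>\<bar> = \<bar>h ?x ?v - H ?v\<bar> / real (Suc n)"
      by (simp add: e_def \<Phi>_def)
    moreover have "?r / real (Suc n) = rate n"
      unfolding rate_def by (simp add: powr_diff add.commute)
    ultimately have "\<bar>e n \<omega>\<bar> \<le> rate n * (A + 4 * norm (V0 \<omega>) + cost_sum ?x)"
      by (metis times_divide_eq_left)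
    from power_mono[OF this abs_ge_zero, of 2]
    have "(e n \<omega>)\<^sup>2 \<le> (rate n)\<^sup>2 * (A + 4 * norm (V0 \<omega>) + cost_sum ?x)\<^sup>2"
      unfolding power_mult_distrib power2_abs .
    also have "\<dots> \<le> (rate n)\<^sup>2 * B n \<omega>"
    proof (rule mult_left_mono)
      have "(a + b + d)\<^sup>2 \<le> 3 * (a\<^sup>2 + b\<^sup>2 + d\<^sup>2)" for a b d :: real
        using zero_le_power2[of "a - b"] zero_le_power2[of "a - d"] zero_le_power2[of "b - d"]
        by (simp add: power2_eq_square algebra_simps)
      from this[of A "4 * norm (V0 \<omega>)" "cost_sum ?x"]
      show "(A + 4 * norm (V0 \<omega>) + cost_sum ?x)\<^sup>2 \<le> B n \<omega>"
        by (simp add: B_def power_mult_distrib)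
    qed simp
    finally show ?thesis .
  qed
  have cs_int: "integrable M (\<lambda>\<omega>. (cost_sum (X (Suc n) \<omega>))\<^sup>2)" for n
    by (rule integrable_fresh(1)[OF integrable_cost_sum_sq])
  have B_int: "integrable M (B n)" for n
    unfolding B_def[abs_def]
    by (intro integrable_mult_right Bochner_Integration.integrable_add cs_int V0_sq) simp
  have B_EB: "(LINT \<omega>|M. B n \<omega>) = EB" for n
  proof -
    have "(LINT \<omega>|M. A\<^sup>2 + 16 * (norm (V0 \<omega>))\<^sup>2 + (cost_sum (X (Suc n) \<omega>))\<^sup>2)
        = (LINT \<omega>|M. A\<^sup>2) + (LINT \<omega>|M. 16 * (norm (V0 \<omega>))\<^sup>2) + (LINT \<omega>|M. (cost_sum (X (Suc n) \<omega>))\<^sup>2)"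
      by (subst Bochner_Integration.integral_add[OF _ cs_int]) (auto simp: V0_sq)
    also have "\<dots> = A\<^sup>2 + 16 * (LINT \<omega>|M. (norm (V0 \<omega>))\<^sup>2) + (LINT x|\<mu>. (cost_sum x)\<^sup>2)"
      by (simp add: prob_space integrable_fresh(2)[OF integrable_cost_sum_sq])
    finally show ?thesis
      by (simp only: B_def EB_def integral_mult_right_zero)
  qed
  have meas: "(\<lambda>\<omega>. (e n \<omega>)\<^sup>2) \<in> borel_measurable M" for n
    unfolding e_def
    by (rule borel_measurable_power[OF measurable_past_M[OF past_prod_comp[OF Phi]]])
  have rB_int: "integrable M (\<lambda>\<omega>. (rate n)\<^sup>2 * B n \<omega>)" for n
    by (intro integrable_mult_right B_int)
  have int: "integrable M (\<lambda>\<omega>. (e n \<omega>)\<^sup>2)" for n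
  proof (rule Bochner_Integration.integrable_bound[OF rB_int meas AE_I2])
    fix \<omega> assume "\<omega> \<in> space M"
    from bound[OF this, of n] show "norm ((e n \<omega>)\<^sup>2) \<le> norm ((rate n)\<^sup>2 * B n \<omega>)"
      by simp
  qed
  have "L2_martingale_diff M past e"
    unfolding e_def[abs_def]
  proof (rule L2_martingale_diffI[OF Phi _ int[unfolded e_def]])
    fix n \<omega>
    have "(LINT x|\<mu>. h x (VX n \<omega>) - H (VX n \<omega>)) = 0"
      by (subst Bochner_Integration.integral_diff)
        (auto simp: integrable_h mu.prob_space H_eps_def)
    then show "(LINT x|\<mu>. \<Phi> n (\<omega>, x)) = 0"
      by (simp add: \<Phi>_def)
  qed
  then interpret L2_martingale_diff M past e .
  have "summable (\<lambda>n. LINT \<omega>|M. (e n \<omega>)\<^sup>2)"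
  proof (rule summable_comparison_test)
    show "summable (\<lambda>n. (rate n)\<^sup>2 * EB)"
      by (intro summable_mult2 summable_rate_sq)
    have "norm (LINT \<omega>|M. (e n \<omega>)\<^sup>2) \<le> (rate n)\<^sup>2 * EB" for n
    proof -
      have "(LINT \<omega>|M. (e n \<omega>)\<^sup>2) \<le> (LINT \<omega>|M. (rate n)\<^sup>2 * B n \<omega>)"
        by (intro integral_mono int rB_int bound)
      then show ?thesis
        by (simp add: B_EB)
    qed
    then show "\<exists>N. \<forall>n\<ge>N. norm (LINT \<omega>|M. (e n \<omega>)\<^sup>2) \<le> (rate n)\<^sup>2 * EB"
      by blast
  qed
  then have "AE \<omega> in M. summable (\<lambda>n. e n \<omega>)"
    by (rule AE_summable)
  then show ?thesis
  proof eventually_elim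
    case (elim \<omega>)
    have "e n \<omega> = (h (X (Suc n) \<omega>) (VX n \<omega>) - H (VX n \<omega>)) / real (Suc n)" for n
      by (simp add: e_def \<Phi>_def)
    with elim show ?case
      by (intro kronecker_mean) simp
  qed
qed

theorem AE_W_hat_tendsto:
  assumes min: "\<And>v. H u \<le> H v"
  shows "AE \<omega> in M. (\<lambda>n. W_hat \<epsilon> c y w lab \<alpha> \<beta> \<gamma> (V0 \<omega>) (\<lambda>n. X n \<omega>) n) \<longlonglongrightarrow> - H u"
  using AE_mean_fluctuation AE_summable_noise AE_space
proof eventually_elim
  case (elim \<omega>)
  have "(\<lambda>n. (\<Sum>k<n. H (VX k \<omega>)) / real n) \<longlonglongrightarrow> H u"
    by (intro cesaro_mean H_V_tendsto V0_perp min elim)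
  with elim(1) have "(\<lambda>n. - ((\<Sum>k<n. h (X (Suc k) \<omega>) (VX k \<omega>) - H (VX k \<omega>)) / real n
      + (\<Sum>k<n. H (VX k \<omega>)) / real n)) \<longlonglongrightarrow> - (0 + H u)"
    by (intro tendsto_minus tendsto_add)
  moreover have "- ((\<Sum>k<n. h (X (Suc k) \<omega>) (VX k \<omega>) - H (VX k \<omega>)) / real n
      + (\<Sum>k<n. H (VX k \<omega>)) / real n) = W_hat \<epsilon> c y w lab \<alpha> \<beta> \<gamma> (V0 \<omega>) (\<lambda>n. X n \<omega>) n" for n
  proof -
    have "(\<Sum>k=1..n. h (X k \<omega>) (VX (k - 1) \<omega>)) = (\<Sum>k<n. h (X (Suc k) \<omega>) (VX k \<omega>))"
      by (rule sum.reindex_bij_witness[of _ Suc "\<lambda>k. k - 1"]) auto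
    then show ?thesis
      by (simp add: W_hat_def sum_subtractf diff_divide_distrib)
  qed
  ultimately show ?case
    by simp
qed

end

theorem corollary3p1:
  fixes \<mu> :: "'a::metric_space measure"
    and y :: "'j::finite \<Rightarrow> 'b::metric_space"
    and w :: "real ^ 'j"
    and c :: "'a \<Rightarrow> 'b \<Rightarrow> real"
    and cX :: "'a \<Rightarrow> real" and cY :: "'b \<Rightarrow> real"
    and \<epsilon> \<alpha> \<beta> \<gamma> :: real
    and vstar :: "real ^ 'j"
    and lab :: "nat \<Rightarrow> 'j"
    and M :: "'w measure"
    and X :: "nat \<Rightarrow> 'w \<Rightarrow> 'a"
    and V0 :: "'w \<Rightarrow> real ^ 'j"
  assumes mu: "prob_space \<mu>" "sets \<mu> = sets borel"
    and y_inj: "inj y"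
    and w_pos: "\<And>j. 0 < w $ j" and w_sum: "(\<Sum>j\<in>UNIV. w $ j) = 1"
    and c_lsc: "lower_semicontinuous (\<lambda>(x, y). c x y)"
    and c_bounds: "\<And>x y. 0 \<le> c x y" "\<And>x y. c x y \<le> cX x + cY y"
    and cX_int: "integrable \<mu> cX" and cY_int: "integrable (discrete_measure y w) cY"
    and eps: "0 < \<epsilon>"
    and vstar: "vstar \<in> v_perp" "\<And>v. H_eps \<epsilon> c y w \<mu> vstar \<le> H_eps \<epsilon> c y w \<mu> v"
    and G_pos: "0 < min_rayleigh_perp (G_eps \<epsilon> c y w \<mu> vstar)"
    and eps_le: "Max (range (($) w)) \<noteq> Min (range (($) w)) \<Longrightarrow>
       \<epsilon> \<le> Min (range (($) w)) / (Max (range (($) w)) - Min (range (($) w)))"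
    and lab: "bij_betw lab {1..CARD('j)} UNIV"
    and M: "prob_space M"
    and X_indep: "prob_space.indep_vars M (\<lambda>_. borel) X {1..}"
    and X_distr: "\<And>n. n \<ge> 1 \<Longrightarrow> distr M borel (X n) = \<mu>"
    and V0: "V0 \<in> borel_measurable M" "integrable M (\<lambda>\<omega>. (norm (V0 \<omega>))\<^sup>2)"
      "\<And>\<omega>. \<omega> \<in> space M \<Longrightarrow> V0 \<omega> \<in> v_perp"
    and V0_indep: "prob_space.indep_set M
       (sets (vimage_algebra (space M) V0 borel))
       (sets (vimage_algebra (space M) (\<lambda>\<omega>. \<lambda>n\<in>{1..}. X n \<omega>) (\<Pi>\<^sub>M n\<in>{1..}. borel)))"
    and alpha: "0 \<le> \<alpha>" "\<alpha> < 1/2" and beta: "0 < \<beta>" "\<beta> < 1/2" and gamma: "0 < \<gamma>"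
    and alpha_beta: "\<alpha> + \<beta> < 1/2"
    and c_sq: "\<And>j. integrable \<mu> (\<lambda>x. (c x (y j))\<^sup>2)"
  shows "AE \<omega> in M.
     (\<lambda>n. ereal (W_hat \<epsilon> c y w lab \<alpha> \<beta> \<gamma> (V0 \<omega>) (\<lambda>n. X n \<omega>) n))
       \<longlonglongrightarrow> W_reg \<epsilon> c \<mu> (discrete_measure y w)"
proof -
  interpret sgn_process \<mu> y w c \<epsilon> lab \<alpha> \<beta> \<gamma> M X V0
  proof (intro sgn_process.intro sgn_algorithm.intro semi_dual.intro sgn_algorithm_axioms.intro
      sgn_process_axioms.intro)
    show "(\<lambda>x. c x (y j)) \<in> borel_measurable borel" for j
      by (rule lower_semicontinuous_borel[OF lower_semicontinuous_slice[OF c_lsc]])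
  qed (fact assms)+
  show ?thesis
    using AE_W_hat_tendsto[OF vstar(2)]
  proof eventually_elim
    case (elim \<omega>)
    then show ?case
      unfolding W_reg_eq[OF vstar(2)] by (intro tendsto_ereal)
  qed
qed

end
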